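(* Let $K$ be a field and let $\mathcal{R}$ be the $9$-dimensional $K$-algebra with basis $\{E,X_1,X_2,Y_1,Y_2\}\cup\{F_{ij}\mid 1\le i,j\le 2\}$ and multiplication given by $E^2=E$, $F_{ij}F_{jr}=F_{ir}$, $EX_i=X_i$, $X_iF_{ir}=X_r$, $F_{ij}Y_j=Y_i$, $Y_iE=Y_i$ for all $1\le i,j,r\le 2$, any other product of two basis elements being zero. Let $\varphi:\mathcal{R}^*\otimes_{\mathcal{R}}\mathcal{R}^*\to\mathcal{R}$ be an isomorphism of $\mathcal{R}$-bimodules. Then the semitrivial extension $\mathcal{R}\rtimes_\varphi\mathcal{R}^*$ is a symmetric strongly $C_2$-graded algebra whose homogeneous component of trivial degree is not Frobenius.
   Context: For a finite-dimensional $K$-algebra $A$, $A^*=\mathrm{Hom}_K(A,K)$ is an $A$-bimodule by $(r\rightharpoonup r^* )(a)=r^*(ar)$ and $(r^*\leftharpoonup r)(a)=r^*(ra)$. $A$ is Frobenius if $A\simeq A^*$ as left $A$-modules, and symmetric if $A\simeq A^*$ as $A$-bimodules. For a group $G$ with neutral element $e$, a $G$-graded algebra $A=\oplus_{g\in G}A_g$ (with $A_gA_h\subset A_{gh}$) is strongly graded if $A_gA_h=A_{gh}$ for all $g,h\in G$; its homogeneous component of trivial degree is $A_e$. The semitrivial extension $\mathcal{R}\rtimes_\varphi\mathcal{R}^*$ is the vector space $\mathcal{R}\times\mathcal{R}^*$ with multiplication $(r,r^* )(s,s^* )=(rs+\varphi(r^*\otimes s^* ),\,(r\rightharpoonup s^*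 )+(r^*\leftharpoonup s))$. With $C_2=\{e,c\}$ the cyclic group of order $2$, its grading has homogeneous component of degree $e$ equal to $\mathcal{R}\times 0$ and of degree $c$ equal to $0\times\mathcal{R}^*$. Isomorphisms $\varphi$ as in the claim exist. For example, writing $E^*,F_{ij}^*,X_i^*,Y_i^*$ for the dual basis, one is the linear map determined by $\varphi(Y_1^*\otimes X_1^* )=E$, $\varphi(X_i^*\otimes Y_j^* )=F_{ij}$, $\varphi(E^*\otimes Y_i^* )=X_i$, $\varphi(F_{1i}^*\otimes X_1^* )=Y_i$ for $1\le i,j\le 2$ (these tensors form a basis of $\mathcal{R}^*\otimes_{\mathcal{R}}\mathcal{R}^*$). *)

theory Defs
  imports "HOL-Algebra.Module" "HOL-Algebra.Free_Abelian_Groups"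
begin

section \<open>Algebras over a field\<close>

text \<open>The library locale \<open>algebra\<close> requires a commutative ring, so it does not apply here.\<close>

locale field_algebra = K?: field K + module K A + A?: ring A
  for K (structure) and A (structure) +
  assumes smult_mult_left:
      "\<lbrakk>a \<in> carrier K; x \<in> carrier A; y \<in> carrier A\<rbrakk>
        \<Longrightarrow> (a \<odot>\<^bsub>A\<^esub> x) \<otimes>\<^bsub>A\<^esub> y = a \<odot>\<^bsub>A\<^esub> (x \<otimes>\<^bsub>A\<^esub> y)"
    and smult_mult_right:
      "\<lbrakk>a \<in> carrier K; x \<in> carrier A; y \<in> carrier A\<rbrakk>
        \<Longrightarrow> x \<otimes>\<^bsub>A\<^esub> (a \<odot>\<^bsub>A\<^esub> y) = a \<odot>\<^bsub>A\<^esub> (x \<otimes>\<^bsub>A\<^esub> y)"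

locale fd_algebra = field_algebra +
  assumes finite_spanning_set:
    "\<exists>S. finite S \<and> S \<subseteq> carrier A \<and>
       (\<forall>x\<in>carrier A. \<exists>c \<in> S \<rightarrow> carrier K. x = (\<Oplus>\<^bsub>A\<^esub>s\<in>S. c s \<odot>\<^bsub>A\<^esub> s))"


section \<open>Bimodules\<close>

text \<open>A bimodule over a ring reuses the library record for modules: \<open>smult\<close> is the left
  action. As there, the inherited multiplication and unit play no role.\<close>

record ('r, 'm) bimodule = "('r, 'm) module" +
  rsmult :: "'m \<Rightarrow> 'r \<Rightarrow> 'm"

definition left_module_isos ::
  "('r, 'x) ring_scheme \<Rightarrow> ('r, 'm, 'y) module_scheme \<Rightarrow> ('r, 'n, 'z) module_scheme
    \<Rightarrow> ('m \<Rightarrow> 'n) set" where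
  "left_module_isos R M N = {f. bij_betw f (carrier M) (carrier N) \<and>
     (\<forall>x\<in>carrier M. \<forall>y\<in>carrier M. f (x \<oplus>\<^bsub>M\<^esub> y) = f x \<oplus>\<^bsub>N\<^esub> f y) \<and>
     (\<forall>r\<in>carrier R. \<forall>x\<in>carrier M. f (r \<odot>\<^bsub>M\<^esub> x) = r \<odot>\<^bsub>N\<^esub> f x)}"

definition bimodule_isos ::
  "('r, 'x) ring_scheme \<Rightarrow> ('r, 'm) bimodule \<Rightarrow> ('r, 'n) bimodule \<Rightarrow> ('m \<Rightarrow> 'n) set" where
  "bimodule_isos R M N = {f \<in> left_module_isos R M N.
     \<forall>r\<in>carrier R. \<forall>x\<in>carrier M. f (rsmult M x r) = rsmult N (f x) r}"

definition regular_bimodule :: "('r, 'x) ring_scheme \<Rightarrow> ('r, 'r) bimodule" where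
  "regular_bimodule R =
     \<lparr>carrier = carrier R, monoid.mult = monoid.mult R, one = \<one>\<^bsub>R\<^esub>, ring.zero = \<zero>\<^bsub>R\<^esub>,
      ring.add = ring.add R, smult = monoid.mult R, rsmult = monoid.mult R\<rparr>"

definition dual_carrier ::
  "('k, 'x) ring_scheme \<Rightarrow> ('k, 'a, 'y) module_scheme \<Rightarrow> ('a \<Rightarrow> 'k) set" where
  "dual_carrier K A = {f \<in> carrier A \<rightarrow>\<^sub>E carrier K.
     (\<forall>x\<in>carrier A. \<forall>y\<in>carrier A. f (x \<oplus>\<^bsub>A\<^esub> y) = f x \<oplus>\<^bsub>K\<^esub> f y) \<and>
     (\<forall>a\<in>carrier K. \<forall>x\<in>carrier A. f (a \<odot>\<^bsub>A\<^esub> x) = a \<otimes>\<^bsub>K\<^esub> f x)}"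

definition dual_bimodule ::
  "('k, 'x) ring_scheme \<Rightarrow> ('k, 'a, 'y) module_scheme \<Rightarrow> ('a, 'a \<Rightarrow> 'k) bimodule" where
  "dual_bimodule K A =
     \<lparr>carrier = dual_carrier K A, monoid.mult = undefined, one = undefined,
      ring.zero = (\<lambda>a\<in>carrier A. \<zero>\<^bsub>K\<^esub>),
      ring.add = (\<lambda>f g. \<lambda>a\<in>carrier A. f a \<oplus>\<^bsub>K\<^esub> g a),
      smult = (\<lambda>r f. \<lambda>a\<in>carrier A. f (a \<otimes>\<^bsub>A\<^esub> r)),
      rsmult = (\<lambda>f r. \<lambda>a\<in>carrier A. f (r \<otimes>\<^bsub>A\<^esub> a))\<rparr>"

text \<open>Both notions are meant for a finite-dimensional \<open>K\<close>-algebra \<open>A\<close>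
  (\<^locale>\<open>fd_algebra\<close>).\<close>

definition frobenius_algebra ::
  "('k, 'x) ring_scheme \<Rightarrow> ('k, 'a, 'y) module_scheme \<Rightarrow> bool" where
  "frobenius_algebra K A \<longleftrightarrow> left_module_isos A (regular_bimodule A) (dual_bimodule K A) \<noteq> {}"

definition symmetric_algebra ::
  "('k, 'x) ring_scheme \<Rightarrow> ('k, 'a, 'y) module_scheme \<Rightarrow> bool" where
  "symmetric_algebra K A \<longleftrightarrow> bimodule_isos A (regular_bimodule A) (dual_bimodule K A) \<noteq> {}"


section \<open>Tensor products of bimodules\<close>

text \<open>\<open>M \<otimes>\<^sub>R N\<close> is the free abelian group on \<open>M \<times> N\<close> (written additively, as finitely
  supported integer-valued functions) modulo the subgroup generated by the relations
  of biadditivity and \<open>R\<close>-balance. Its elements are cosets.\<close>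

definition tensor_free ::
  "('r, 'm) bimodule \<Rightarrow> ('r, 'n) bimodule \<Rightarrow> ('m \<times> 'n \<Rightarrow>\<^sub>0 int) monoid" where
  "tensor_free M N = free_Abelian_group (carrier M \<times> carrier N)"

definition tensor_relations ::
  "('r, 'x) ring_scheme \<Rightarrow> ('r, 'm) bimodule \<Rightarrow> ('r, 'n) bimodule \<Rightarrow> ('m \<times> 'n \<Rightarrow>\<^sub>0 int) set" where
  "tensor_relations R M N = generate (tensor_free M N)
     ({frag_of (x \<oplus>\<^bsub>M\<^esub> x', y) - frag_of (x, y) - frag_of (x', y) | x x' y.
         x \<in> carrier M \<and> x' \<in> carrier M \<and> y \<in> carrier N} \<union>
      {frag_of (x, y \<oplus>\<^bsub>N\<^esub> y') - frag_of (x, y) - frag_of (x, y') | x y y'.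
         x \<in> carrier M \<and> y \<in> carrier N \<and> y' \<in> carrier N} \<union>
      {frag_of (rsmult M x r, y) - frag_of (x, r \<odot>\<^bsub>N\<^esub> y) | x r y.
         x \<in> carrier M \<and> r \<in> carrier R \<and> y \<in> carrier N})"

definition tensor_class ::
  "('r, 'x) ring_scheme \<Rightarrow> ('r, 'm) bimodule \<Rightarrow> ('r, 'n) bimodule
    \<Rightarrow> ('m \<times> 'n \<Rightarrow>\<^sub>0 int) \<Rightarrow> ('m \<times> 'n \<Rightarrow>\<^sub>0 int) set" where
  "tensor_class R M N c = tensor_relations R M N #>\<^bsub>tensor_free M N\<^esub> c"

definition pure_tensor ::
  "('r, 'x) ring_scheme \<Rightarrow> ('r, 'm) bimodule \<Rightarrow> ('r, 'n) bimodule
    \<Rightarrow> 'm \<Rightarrow> 'n \<Rightarrow> ('m \<times> 'n \<Rightarrow>\<^sub>0 int) set" where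
  "pure_tensor R M N x y = tensor_class R M N (frag_of (x, y))"

text \<open>The actions are \<open>r(x \<otimes> y) = rx \<otimes> y\<close> and \<open>(x \<otimes> y)r = x \<otimes> yr\<close>, extended additively to the
  free group. The unions range over all representatives of a coset \<open>U\<close>; they all yield
  the same class.\<close>

definition tensor_bimodule ::
  "('r, 'x) ring_scheme \<Rightarrow> ('r, 'm) bimodule \<Rightarrow> ('r, 'n) bimodule
    \<Rightarrow> ('r, ('m \<times> 'n \<Rightarrow>\<^sub>0 int) set) bimodule" where
  "tensor_bimodule R M N =
     \<lparr>carrier = carrier (tensor_free M N Mod tensor_relations R M N),
      monoid.mult = undefined, one = undefined,
      ring.zero = \<one>\<^bsub>tensor_free M N Mod tensor_relations R M N\<^esub>,
      ring.add = monoid.mult (tensor_free M N Mod tensor_relations R M N),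
      smult = (\<lambda>r U. \<Union>c\<in>U. tensor_class R M N
                 (frag_extend (\<lambda>(x, y). frag_of (r \<odot>\<^bsub>M\<^esub> x, y)) c)),
      rsmult = (\<lambda>U r. \<Union>c\<in>U. tensor_class R M N
                 (frag_extend (\<lambda>(x, y). frag_of (x, rsmult N y r)) c))\<rparr>"


section \<open>Graded algebras\<close>

definition graded_algebra ::
  "('k, 'x) ring_scheme \<Rightarrow> ('g, 'y) monoid_scheme \<Rightarrow> ('k, 'a, 'z) module_scheme
    \<Rightarrow> ('g \<Rightarrow> 'a set) \<Rightarrow> bool" where
  "graded_algebra K G A \<A> \<longleftrightarrow> field_algebra K A \<and> group G \<and>
     (\<forall>g\<in>carrier G. submodule (\<A> g) K A) \<and>
     (\<forall>x\<in>carrier A. \<exists>!u. u \<in> (\<Pi>\<^sub>E g\<in>carrier G. \<A> g) \<and>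
        finite {g \<in> carrier G. u g \<noteq> \<zero>\<^bsub>A\<^esub>} \<and>
        x = (\<Oplus>\<^bsub>A\<^esub>g\<in>{g \<in> carrier G. u g \<noteq> \<zero>\<^bsub>A\<^esub>}. u g)) \<and>
     (\<forall>g\<in>carrier G. \<forall>h\<in>carrier G. \<forall>x\<in>\<A> g. \<forall>y\<in>\<A> h. x \<otimes>\<^bsub>A\<^esub> y \<in> \<A> (g \<otimes>\<^bsub>G\<^esub> h))"

text \<open>\<open>A\<^sub>g A\<^sub>h\<close> denotes the additive subgroup generated by the products of elements.\<close>

definition strongly_graded_algebra ::
  "('k, 'x) ring_scheme \<Rightarrow> ('g, 'y) monoid_scheme \<Rightarrow> ('k, 'a, 'z) module_scheme
    \<Rightarrow> ('g \<Rightarrow> 'a set) \<Rightarrow> bool" where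
  "strongly_graded_algebra K G A \<A> \<longleftrightarrow> graded_algebra K G A \<A> \<and>
     (\<forall>g\<in>carrier G. \<forall>h\<in>carrier G.
        generate (add_monoid A) {x \<otimes>\<^bsub>A\<^esub> y | x y. x \<in> \<A> g \<and> y \<in> \<A> h} = \<A> (g \<otimes>\<^bsub>G\<^esub> h))"

definition trivial_component ::
  "('g, 'y) monoid_scheme \<Rightarrow> ('k, 'a, 'z) module_scheme \<Rightarrow> ('g \<Rightarrow> 'a set)
    \<Rightarrow> ('k, 'a, 'z) module_scheme" where
  "trivial_component G A \<A> = A\<lparr>carrier := \<A> \<one>\<^bsub>G\<^esub>\<rparr>"

text \<open>\<open>C\<^sub>2\<close> has carrier \<open>{0, 1}\<close>: here \<open>e = 0\<close> and \<open>c = 1\<close>.\<close>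

abbreviation C2 :: "int monoid" where
  "C2 \<equiv> integer_mod_group 2"


section \<open>Semitrivial extensions\<close>

text \<open>No associativity condition is imposed on \<open>\<phi>\<close>, so that this structure is an algebra
  has to be proved where it is claimed.\<close>

definition semitrivial_extension ::
  "('k, 'x) ring_scheme \<Rightarrow> ('k, 'a, 'y) module_scheme
    \<Rightarrow> ((('a \<Rightarrow> 'k) \<times> ('a \<Rightarrow> 'k) \<Rightarrow>\<^sub>0 int) set \<Rightarrow> 'a) \<Rightarrow> ('k, 'a \<times> ('a \<Rightarrow> 'k)) module" where
  "semitrivial_extension K A \<phi> = (let D = dual_bimodule K A in
     \<lparr>carrier = carrier A \<times> carrier D,
      monoid.mult = (\<lambda>(r, f) (s, g).
        ((r \<otimes>\<^bsub>A\<^esub> s) \<oplus>\<^bsub>A\<^esub> \<phi> (pure_tensor A D D f g), (r \<odot>\<^bsub>D\<^esub> g) \<oplus>\<^bsub>D\<^esub> rsmult D f s)),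
      one = (\<one>\<^bsub>A\<^esub>, \<zero>\<^bsub>D\<^esub>),
      ring.zero = (\<zero>\<^bsub>A\<^esub>, \<zero>\<^bsub>D\<^esub>),
      ring.add = (\<lambda>(r, f) (s, g). (r \<oplus>\<^bsub>A\<^esub> s, f \<oplus>\<^bsub>D\<^esub> g)),
      smult = (\<lambda>k (r, f). (k \<odot>\<^bsub>A\<^esub> r, \<lambda>a\<in>carrier A. k \<otimes>\<^bsub>K\<^esub> f a))\<rparr>)"

definition semitrivial_grading ::
  "('k, 'x) ring_scheme \<Rightarrow> ('k, 'a, 'y) module_scheme \<Rightarrow> int \<Rightarrow> ('a \<times> ('a \<Rightarrow> 'k)) set" where
  "semitrivial_grading K A g =
     (if g = 0 then carrier A \<times> {\<zero>\<^bsub>dual_bimodule K A\<^esub>}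
      else {\<zero>\<^bsub>A\<^esub>} \<times> carrier (dual_bimodule K A))"


section \<open>The nine-dimensional algebra\<close>

datatype idx = I1 | I2

datatype R9_basis = eE | eX idx | eY idx | eF idx idx

text \<open>\<open>None\<close> stands for a zero product.\<close>

fun R9_basis_mult :: "R9_basis \<Rightarrow> R9_basis \<Rightarrow> R9_basis option" where
  "R9_basis_mult eE eE = Some eE"
| "R9_basis_mult (eF i j) (eF k r) = (if j = k then Some (eF i r) else None)"
| "R9_basis_mult eE (eX i) = Some (eX i)"
| "R9_basis_mult (eX i) (eF k r) = (if i = k then Some (eX r) else None)"
| "R9_basis_mult (eF i j) (eY k) = (if j = k then Some (eY i) else None)"
| "R9_basis_mult (eY i) eE = Some (eY i)"
| "R9_basis_mult _ _ = None"

text \<open>An element is its family of coordinates; the unit is \<open>E + F\<^sub>1\<^sub>1 + F\<^sub>2\<^sub>2\<close>.\<close>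

definition R9 :: "('k, 'x) ring_scheme \<Rightarrow> ('k, R9_basis \<Rightarrow> 'k) module" where
  "R9 K =
     \<lparr>carrier = UNIV \<rightarrow> carrier K,
      monoid.mult = (\<lambda>x y b. \<Oplus>\<^bsub>K\<^esub>t\<in>{(p, q). R9_basis_mult p q = Some b}.
        x (fst t) \<otimes>\<^bsub>K\<^esub> y (snd t)),
      one = (\<lambda>b. if b \<in> {eE, eF I1 I1, eF I2 I2} then \<one>\<^bsub>K\<^esub> else \<zero>\<^bsub>K\<^esub>),
      ring.zero = (\<lambda>b. \<zero>\<^bsub>K\<^esub>),
      ring.add = (\<lambda>x y b. x b \<oplus>\<^bsub>K\<^esub> y b),
      smult = (\<lambda>k x b. k \<otimes>\<^bsub>K\<^esub> x b)\<rparr>"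

end

theory Submission
  imports Defs "HOL-Algebra.Subrings"
begin

text \<open>Write \<open>\<phi>(f, g)\<close> for the image of \<open>f \<otimes> g\<close>, and let starred letters be the dual basis.
  Every element of the dual basis arises from \<open>X\<^sub>1*\<close> or \<open>Y\<^sub>1*\<close> by the two actions, e.g.
  \<open>X\<^sub>i* = F\<^sub>i\<^sub>1 X\<^sub>1*\<close>, \<open>E* = X\<^sub>1 X\<^sub>1*\<close> and \<open>F\<^sub>i\<^sub>j* = X\<^sub>j* X\<^sub>i\<close>. Bilinearity and balance therefore
  determine \<open>\<phi>\<close> up to the scalar \<open>\<mu>\<close> with \<open>\<phi>(X\<^sub>1*, Y\<^sub>1*) = \<mu> F\<^sub>1\<^sub>1\<close>: it is \<open>\<mu>\<close> times the map given
  in the paper. For that map the identity \<open>\<phi>(f, g) h = f \<phi>(g, h)\<close>, which is exactly associativity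
  of the semitrivial extension, is a finite check on basis elements.

  The functional \<open>(r, f) \<mapsto> f(1)\<close> sends \<open>(r, f)(s, g)\<close> to \<open>g(r) + f(s)\<close>, because
  \<open>\<phi>\<close> does not contribute to the second component. This is a nondegenerate symmetric associative
  form, so the extension is symmetric. Surjectivity of \<open>\<phi>\<close> gives strong gradedness.

  The nine-dimensional algebra is not Frobenius: a left linear isomorphism onto the dual would send
  \<open>X\<^sub>1\<close> and \<open>X\<^sub>2\<close>, which are fixed by \<open>E\<close> and killed by the \<open>Y\<^sub>j\<close>, into the line spanned
  by \<open>E*\<close>.\<close>

section \<open>Tensor products of bimodules\<close>

locale ring_bimodule = R?: ring R + M?: abelian_group M
  for R :: "('r, 'x) ring_scheme" (structure) and M :: "('r, 'm) bimodule" (structure) +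
  assumes left_closed: "\<lbrakk>r \<in> carrier R; x \<in> carrier M\<rbrakk> \<Longrightarrow> r \<odot>\<^bsub>M\<^esub> x \<in> carrier M"
    and right_closed: "\<lbrakk>r \<in> carrier R; x \<in> carrier M\<rbrakk> \<Longrightarrow> rsmult M x r \<in> carrier M"
    and left_add_scalar: "\<lbrakk>r \<in> carrier R; s \<in> carrier R; x \<in> carrier M\<rbrakk>
        \<Longrightarrow> (r \<oplus>\<^bsub>R\<^esub> s) \<odot>\<^bsub>M\<^esub> x = r \<odot>\<^bsub>M\<^esub> x \<oplus>\<^bsub>M\<^esub> s \<odot>\<^bsub>M\<^esub> x"
    and right_add_scalar: "\<lbrakk>r \<in> carrier R; s \<in> carrier R; x \<in> carrier M\<rbrakk>
        \<Longrightarrow> rsmult M x (r \<oplus>\<^bsub>R\<^esub> s) = rsmult M x r \<oplus>\<^bsub>M\<^esub> rsmult M x s"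
    and left_add: "\<lbrakk>r \<in> carrier R; x \<in> carrier M; y \<in> carrier M\<rbrakk>
        \<Longrightarrow> r \<odot>\<^bsub>M\<^esub> (x \<oplus>\<^bsub>M\<^esub> y) = r \<odot>\<^bsub>M\<^esub> x \<oplus>\<^bsub>M\<^esub> r \<odot>\<^bsub>M\<^esub> y"
    and right_add: "\<lbrakk>r \<in> carrier R; x \<in> carrier M; y \<in> carrier M\<rbrakk>
        \<Longrightarrow> rsmult M (x \<oplus>\<^bsub>M\<^esub> y) r = rsmult M x r \<oplus>\<^bsub>M\<^esub> rsmult M y r"
    and left_mult: "\<lbrakk>r \<in> carrier R; s \<in> carrier R; x \<in> carrier M\<rbrakk>
        \<Longrightarrow> (r \<otimes>\<^bsub>R\<^esub> s) \<odot>\<^bsub>M\<^esub> x = r \<odot>\<^bsub>M\<^esub> (s \<odot>\<^bsub>M\<^esub> x)"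
    and right_mult: "\<lbrakk>r \<in> carrier R; s \<in> carrier R; x \<in> carrier M\<rbrakk>
        \<Longrightarrow> rsmult M x (r \<otimes>\<^bsub>R\<^esub> s) = rsmult M (rsmult M x r) s"
    and left_right: "\<lbrakk>r \<in> carrier R; s \<in> carrier R; x \<in> carrier M\<rbrakk>
        \<Longrightarrow> rsmult M (r \<odot>\<^bsub>M\<^esub> x) s = r \<odot>\<^bsub>M\<^esub> rsmult M x s"
    and left_one: "x \<in> carrier M \<Longrightarrow> \<one>\<^bsub>R\<^esub> \<odot>\<^bsub>M\<^esub> x = x"
    and right_one: "x \<in> carrier M \<Longrightarrow> rsmult M x \<one>\<^bsub>R\<^esub> = x"

locale bimodule_tensor = M: ring_bimodule R M + N: ring_bimodule R N
  for R :: "('r, 'x) ring_scheme" and M :: "('r, 'm) bimodule" and N :: "('r, 'n) bimodule"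
begin

abbreviation "F \<equiv> tensor_free M N"
abbreviation "H \<equiv> tensor_relations R M N"
abbreviation "T \<equiv> tensor_bimodule R M N"
abbreviation "pure \<equiv> pure_tensor R M N"

text \<open>The generating set inside \<open>tensor_relations\<close>, named so that maps on the
  free group can be tested on generators.\<close>

definition "tensor_generators =
   {frag_of (x \<oplus>\<^bsub>M\<^esub> x', y) - frag_of (x, y) - frag_of (x', y) | x x' y.
       x \<in> carrier M \<and> x' \<in> carrier M \<and> y \<in> carrier N} \<union>
   {frag_of (x, y \<oplus>\<^bsub>N\<^esub> y') - frag_of (x, y) - frag_of (x, y') | x y y'.
       x \<in> carrier M \<and> y \<in> carrier N \<and> y' \<in> carrier N} \<union>
   {frag_of (rsmult M x r, y) - frag_of (x, r \<odot>\<^bsub>N\<^esub> y) | x r y.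
       x \<in> carrier M \<and> r \<in> carrier R \<and> y \<in> carrier N}"

lemma tensor_relations_eq: "H = generate F tensor_generators"
  by (simp add: tensor_relations_def tensor_generators_def)

lemma tensor_free_simps [simp]:
  "x \<otimes>\<^bsub>F\<^esub> y = x + y" "\<one>\<^bsub>F\<^esub> = 0"
  "c \<in> carrier F \<longleftrightarrow> Poly_Mapping.keys c \<subseteq> carrier M \<times> carrier N"
  by (simp_all add: tensor_free_def)

lemma comm_group_free: "comm_group F"
  by (simp add: tensor_free_def abelian_free_Abelian_group)

sublocale F: comm_group F
  by (rule comm_group_free)

lemma inv_free: "c \<in> carrier F \<Longrightarrow> inv\<^bsub>F\<^esub> c = - c"
  by (simp add: tensor_free_def)

lemma frag_diff_carrier:
  "\<lbrakk>c \<in> carrier F; c' \<in> carrier F\<rbrakk> \<Longrightarrow> c - c' \<in> carrier F"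
  by (metis F.inv_closed F.m_closed diff_conv_add_uminus inv_free tensor_free_simps(1))

lemma frag_of_carrier:
  "\<lbrakk>x \<in> carrier M; y \<in> carrier N\<rbrakk> \<Longrightarrow> frag_of (x, y) \<in> carrier F"
  by simp

lemma tensor_generators_carrier: "tensor_generators \<subseteq> carrier F"
  unfolding tensor_generators_def
  by (auto simp del: tensor_free_simps
      intro!: frag_diff_carrier frag_of_carrier M.left_closed M.right_closed N.left_closed)

lemma subgroup_relations: "subgroup H F"
  unfolding tensor_relations_eq by (rule F.generate_is_subgroup[OF tensor_generators_carrier])

lemma normal_relations: "H \<lhd> F"
  using F.subgroup_imp_normal subgroup_relations by blast

lemma tensor_class_eqI:
  assumes "c \<in> carrier F" "c' \<in> carrier F" "c - c' \<in> H"
  shows "tensor_class R M N c = tensor_class R M N c'"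
proof -
  have "c \<in> H #>\<^bsub>F\<^esub> c'"
    using assms(3) by (force simp: r_coset_def)
  then show ?thesis
    unfolding tensor_class_def
    using F.repr_independence assms(2) subgroup_relations by blast
qed

lemma tensor_class_carrier: "c \<in> carrier F \<Longrightarrow> tensor_class R M N c \<in> carrier T"
  by (auto simp: tensor_bimodule_def tensor_class_def FactGroup_def RCOSETS_def)

lemma tensor_class_add:
  assumes "c \<in> carrier F" "c' \<in> carrier F"
  shows "tensor_class R M N (c + c') = tensor_class R M N c \<oplus>\<^bsub>T\<^esub> tensor_class R M N c'"
  using normal.rcos_sum[OF normal_relations assms]
  by (simp add: tensor_bimodule_def tensor_class_def)

lemma tensor_class_cases:
  assumes "U \<in> carrier T"
  obtains c where "c \<in> carrier F" "U = tensor_class R M N c"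
  using assms by (auto simp: tensor_bimodule_def tensor_class_def FactGroup_def RCOSETS_def)

lemma pure_carrier: "\<lbrakk>x \<in> carrier M; y \<in> carrier N\<rbrakk> \<Longrightarrow> pure x y \<in> carrier T"
  unfolding pure_tensor_def by (intro tensor_class_carrier frag_of_carrier)

lemma relations_incl: "c \<in> tensor_generators \<Longrightarrow> c \<in> H"
  unfolding tensor_relations_eq by (rule generate.incl)

lemma pure_add_left:
  assumes "x \<in> carrier M" "x' \<in> carrier M" "y \<in> carrier N"
  shows "pure (x \<oplus>\<^bsub>M\<^esub> x') y = pure x y \<oplus>\<^bsub>T\<^esub> pure x' y"
proof -
  have "frag_of (x \<oplus>\<^bsub>M\<^esub> x', y) - (frag_of (x, y) + frag_of (x', y)) \<in> H"
    using assms by (intro relations_incl) (auto simp: tensor_generators_def diff_diff_eq)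
  moreover have "frag_of (x, y) + frag_of (x', y) \<in> carrier F"
    using assms F.m_closed[of "frag_of (x, y)" "frag_of (x', y)"] by simp
  ultimately show ?thesis
    using assms tensor_class_add[OF frag_of_carrier frag_of_carrier, of x y x' y]
      tensor_class_eqI[of "frag_of (x \<oplus>\<^bsub>M\<^esub> x', y)" "frag_of (x, y) + frag_of (x', y)"]
    unfolding pure_tensor_def by auto
qed

lemma pure_add_right:
  assumes "x \<in> carrier M" "y \<in> carrier N" "y' \<in> carrier N"
  shows "pure x (y \<oplus>\<^bsub>N\<^esub> y') = pure x y \<oplus>\<^bsub>T\<^esub> pure x y'"
proof -
  have "frag_of (x, y \<oplus>\<^bsub>N\<^esub> y') - (frag_of (x, y) + frag_of (x, y')) \<in> H"
    using assms by (intro relations_incl) (auto simp: tensor_generators_def diff_diff_eq)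
  moreover have "frag_of (x, y) + frag_of (x, y') \<in> carrier F"
    using assms F.m_closed[of "frag_of (x, y)" "frag_of (x, y')"] by simp
  ultimately show ?thesis
    using assms tensor_class_add[OF frag_of_carrier frag_of_carrier, of x y x y']
      tensor_class_eqI[of "frag_of (x, y \<oplus>\<^bsub>N\<^esub> y')" "frag_of (x, y) + frag_of (x, y')"]
    unfolding pure_tensor_def by auto
qed

lemma pure_balanced:
  assumes "x \<in> carrier M" "r \<in> carrier R" "y \<in> carrier N"
  shows "pure (rsmult M x r) y = pure x (r \<odot>\<^bsub>N\<^esub> y)"
proof -
  have "frag_of (rsmult M x r, y) - frag_of (x, r \<odot>\<^bsub>N\<^esub> y) \<in> H"
    using assms by (intro relations_incl) (auto simp: tensor_generators_def)
  then show ?thesis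
    using assms unfolding pure_tensor_def
    by (intro tensor_class_eqI) (auto intro: M.right_closed N.left_closed)
qed

lemma mem_pure: "c \<in> pure x y \<longleftrightarrow> (\<exists>h\<in>H. c = h + frag_of (x, y))"
  by (simp add: pure_tensor_def tensor_class_def r_coset_def)

text \<open>\<open>frag_extend f\<close> is a group homomorphism, so mapping the generators of
  \<open>H\<close> into \<open>H\<close> is enough for it to preserve \<open>H\<close>. This is what
  makes the actions on tensors well defined.\<close>

lemma frag_extend_relations:
  assumes gen: "\<And>c. c \<in> tensor_generators \<Longrightarrow> frag_extend f c \<in> H" and "h \<in> H"
  shows "frag_extend f h \<in> H"
  using \<open>h \<in> H\<close>[unfolded tensor_relations_eq]
proof (induction h)
  case one
  show ?case
    using subgroup.one_closed[OF subgroup_relations] by simp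
next
  case (incl h)
  then show ?case by (rule gen)
next
  case (inv h)
  have "inv\<^bsub>F\<^esub> frag_extend f h = - frag_extend f h"
    using gen[OF inv] subgroup.mem_carrier[OF subgroup_relations] by (intro inv_free) blast
  moreover have "inv\<^bsub>F\<^esub> h = - h"
    using inv tensor_generators_carrier by (intro inv_free) blast
  ultimately show ?case
    using subgroup.m_inv_closed[OF subgroup_relations gen[OF inv]]
    by (simp add: frag_extend_minus)
next
  case (eng h1 h2)
  then show ?case
    using subgroup.m_closed[OF subgroup_relations] by (simp add: frag_extend_add)
qed

text \<open>The actions on the tensor product are unions over all representatives of a coset.
  Representatives of a pure tensor differ from \<open>frag_of (x, y)\<close> by an element of
  \<open>H\<close>, which \<open>frag_extend f\<close> keeps in \<open>H\<close>; hence all members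
  of the union are one and the same coset.\<close>

lemma UN_tensor_class_frag_extend:
  assumes gen: "\<And>c. c \<in> tensor_generators \<Longrightarrow> frag_extend f c \<in> H"
    and f: "f (x, y) \<in> carrier F"
  shows "(\<Union>c\<in>pure x y. tensor_class R M N (frag_extend f c)) = tensor_class R M N (f (x, y))"
proof -
  have "tensor_class R M N (frag_extend f c) = tensor_class R M N (f (x, y))"
    if "c \<in> pure x y" for c
  proof -
    obtain h where h: "h \<in> H" and c: "c = h + frag_of (x, y)"
      using \<open>c \<in> pure x y\<close> unfolding mem_pure by blast
    have ext: "frag_extend f c = frag_extend f h + f (x, y)"
      by (simp add: c frag_extend_add)
    have h': "frag_extend f h \<in> H"
      using gen h by (rule frag_extend_relations)
    then have "frag_extend f h \<in> carrier F"
      using subgroup.mem_carrier[OF subgroup_relations] by blast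
    then have "frag_extend f c \<in> carrier F"
      using F.m_closed f unfolding ext by fastforce
    then show ?thesis
      using h' f by (intro tensor_class_eqI) (auto simp: ext)
  qed
  \<comment> \<open>The index set of the union is nonempty, so the union really is the common
    coset.\<close>
  moreover have "frag_of (x, y) \<in> pure x y"
    using subgroup.one_closed[OF subgroup_relations]
    by (simp add: mem_pure)
  ultimately show ?thesis by blast
qed

text \<open>Acting on the left factor sends each of the three kinds of relations to relations of the
  same kind. For the balance relation this needs that the left and right actions on \<open>M\<close>
  commute.\<close>

lemma smult_pure:
  assumes "r \<in> carrier R" "x \<in> carrier M" "y \<in> carrier N"
  shows "r \<odot>\<^bsub>T\<^esub> pure x y = pure (r \<odot>\<^bsub>M\<^esub> x) y"
proof -
  let ?f = "\<lambda>(x, y). frag_of (r \<odot>\<^bsub>M\<^esub> x, y) :: 'm \<times> 'n \<Rightarrow>\<^sub>0 int"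
  have "frag_extend ?f c \<in> tensor_generators" if "c \<in> tensor_generators" for c
    using that[unfolded tensor_generators_def] assms(1)
    apply (elim UnE CollectE exE conjE)
    subgoal for x x' y
      unfolding tensor_generators_def
      by (rule UnI1, rule UnI1, simp add: frag_extend_diff M.left_add) (blast intro: M.left_closed)
    subgoal for x y y'
      unfolding tensor_generators_def
      by (rule UnI1, rule UnI2, simp add: frag_extend_diff) (blast intro: M.left_closed)
    subgoal for x s y
      unfolding tensor_generators_def
      by (rule UnI2, simp add: frag_extend_diff M.left_right[symmetric]) (blast intro: M.left_closed)
    done
  then have "(\<Union>c\<in>pure x y. tensor_class R M N (frag_extend ?f c)) = tensor_class R M N (?f (x, y))"
    using assms by (intro UN_tensor_class_frag_extend relations_incl) (auto intro: M.left_closed)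
  then show ?thesis
    by (simp add: tensor_bimodule_def pure_tensor_def[of R M N "r \<odot>\<^bsub>M\<^esub> x"])
qed

lemma rsmult_pure:
  assumes "r \<in> carrier R" "x \<in> carrier M" "y \<in> carrier N"
  shows "rsmult T (pure x y) r = pure x (rsmult N y r)"
proof -
  let ?f = "\<lambda>(x, y). frag_of (x, rsmult N y r) :: 'm \<times> 'n \<Rightarrow>\<^sub>0 int"
  have "frag_extend ?f c \<in> tensor_generators" if "c \<in> tensor_generators" for c
    using that[unfolded tensor_generators_def] assms(1)
    apply (elim UnE CollectE exE conjE)
    subgoal for x x' y
      unfolding tensor_generators_def
      by (rule UnI1, rule UnI1, simp add: frag_extend_diff) (blast intro: N.right_closed)
    subgoal for x y y'
      unfolding tensor_generators_def
      by (rule UnI1, rule UnI2, simp add: frag_extend_diff N.right_add) (blast intro: N.right_closed)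
    subgoal for x s y
      unfolding tensor_generators_def
      by (rule UnI2, simp add: frag_extend_diff N.left_right) (blast intro: N.right_closed)
    done
  then have "(\<Union>c\<in>pure x y. tensor_class R M N (frag_extend ?f c)) = tensor_class R M N (?f (x, y))"
    using assms by (intro UN_tensor_class_frag_extend relations_incl) (auto intro: N.right_closed)
  then show ?thesis
    by (simp add: tensor_bimodule_def pure_tensor_def[of R M N x])
qed

text \<open>The free group is generated by the \<open>frag_of (x, y)\<close>, so pure tensors
  generate the tensor product additively, and their images generate the image of any additive
  map.\<close>

lemma additive_image_generate:
  assumes G: "abelian_group G"
    and maps: "\<And>U. U \<in> carrier T \<Longrightarrow> \<psi> U \<in> carrier G"
    and add: "\<And>U V. \<lbrakk>U \<in> carrier T; V \<in> carrier T\<rbrakk> \<Longrightarrow> \<psi> (U \<oplus>\<^bsub>T\<^esub> V) = \<psi> U \<oplus>\<^bsub>G\<^esub> \<psi> V"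
    and U: "U \<in> carrier T"
  shows "\<psi> U \<in> generate (add_monoid G) {\<psi> (pure x y) | x y. x \<in> carrier M \<and> y \<in> carrier N}"
    (is "_ \<in> ?S")
proof -
  interpret G: abelian_group G by (rule G)
  let ?\<chi> = "\<lambda>c. \<psi> (tensor_class R M N c)"
  have hom: "?\<chi> (c + c') = ?\<chi> c \<oplus>\<^bsub>G\<^esub> ?\<chi> c'" if "c \<in> carrier F" "c' \<in> carrier F" for c c'
    using that by (simp del: tensor_free_simps add: tensor_class_add add tensor_class_carrier)
  have S: "subgroup ?S (add_monoid G)"
    using maps pure_carrier by (intro G.add.generate_is_subgroup) auto
  have closed: "?\<chi> c \<in> carrier G" if "c \<in> carrier F" for c
    using that maps tensor_class_carrier by blast
  have zero: "?\<chi> 0 = \<zero>\<^bsub>G\<^esub>"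
    using hom[of 0 0] closed[of 0] by simp
  obtain c where c: "c \<in> carrier F" "U = tensor_class R M N c"
    using U by (rule tensor_class_cases)
  have "Poly_Mapping.keys c \<subseteq> carrier M \<times> carrier N"
    using c by simp
  \<comment> \<open>Membership in the carrier is carried through the induction because additivity of
    \<open>\<psi>\<close> on classes is known only there.\<close>
  then have "c \<in> carrier F \<and> ?\<chi> c \<in> ?S"
  proof (induction c rule: frag_induction)
    case zero
    then show ?case
      using subgroup.one_closed[OF S] \<open>?\<chi> 0 = \<zero>\<^bsub>G\<^esub>\<close> by simp
  next
    case (one z)
    then show ?case
      by (cases z) (auto intro!: generate.incl simp: pure_tensor_def[symmetric])
  next
    case (diff a b)
    then have ab: "a - b \<in> carrier F"
      using frag_diff_carrier by blast
    \<comment> \<open>Only sums are known to be preserved, so the difference is reached by writing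
      \<open>a\<close> as \<open>(a - b) + b\<close>.\<close>
    have "?\<chi> a = ?\<chi> (a - b) \<oplus>\<^bsub>G\<^esub> ?\<chi> b"
      using hom[of "a - b" b] ab diff by simp
    then have "?\<chi> (a - b) = ?\<chi> a \<ominus>\<^bsub>G\<^esub> ?\<chi> b"
      using closed ab diff by (metis G.add.inv_closed G.add.inv_solve_right a_minus_def)
    then show ?case
      using ab diff subgroup.m_closed[OF S] subgroup.m_inv_closed[OF S]
      by (simp add: a_minus_def a_inv_def)
  qed
  then show ?thesis
    using c by simp
qed

end


section \<open>Duals of algebras\<close>

context field_algebra
begin

abbreviation "D \<equiv> dual_bimodule K A"

lemma dual_carrier_simp: "carrier D = dual_carrier K A"
  by (simp add: dual_bimodule_def)

lemma dual_apply [simp]: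
  "a \<in> carrier A \<Longrightarrow> \<zero>\<^bsub>D\<^esub> a = \<zero>\<^bsub>K\<^esub>"
  "a \<in> carrier A \<Longrightarrow> (f \<oplus>\<^bsub>D\<^esub> g) a = f a \<oplus>\<^bsub>K\<^esub> g a"
  "a \<in> carrier A \<Longrightarrow> (r \<odot>\<^bsub>D\<^esub> f) a = f (a \<otimes>\<^bsub>A\<^esub> r)"
  "a \<in> carrier A \<Longrightarrow> (rsmult D f r) a = f (r \<otimes>\<^bsub>A\<^esub> a)"
  by (simp_all add: dual_bimodule_def)

lemma dual_closed [simp]: "\<lbrakk>f \<in> carrier D; x \<in> carrier A\<rbrakk> \<Longrightarrow> f x \<in> carrier K"
  by (auto simp: dual_carrier_simp dual_carrier_def)

lemma dual_add [simp]:
  "\<lbrakk>f \<in> carrier D; x \<in> carrier A; y \<in> carrier A\<rbrakk> \<Longrightarrow> f (x \<oplus>\<^bsub>A\<^esub> y) = f x \<oplus>\<^bsub>K\<^esub> f y"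
  by (auto simp: dual_carrier_simp dual_carrier_def)

lemma dual_smult [simp]:
  "\<lbrakk>f \<in> carrier D; a \<in> carrier K; x \<in> carrier A\<rbrakk> \<Longrightarrow> f (a \<odot>\<^bsub>A\<^esub> x) = a \<otimes>\<^bsub>K\<^esub> f x"
  by (auto simp: dual_carrier_simp dual_carrier_def)

lemma dual_zero [simp]: "f \<in> carrier D \<Longrightarrow> f \<zero>\<^bsub>A\<^esub> = \<zero>\<^bsub>K\<^esub>"
  using dual_smult[of f "\<zero>\<^bsub>K\<^esub>" "\<zero>\<^bsub>A\<^esub>"] by simp

lemma dual_memI:
  assumes "f \<in> extensional (carrier A)"
    and "\<And>x. x \<in> carrier A \<Longrightarrow> f x \<in> carrier K"
    and "\<And>x y. \<lbrakk>x \<in> carrier A; y \<in> carrier A\<rbrakk> \<Longrightarrow> f (x \<oplus>\<^bsub>A\<^esub> y) = f x \<oplus>\<^bsub>K\<^esub> f y"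
    and "\<And>a x. \<lbrakk>a \<in> carrier K; x \<in> carrier A\<rbrakk> \<Longrightarrow> f (a \<odot>\<^bsub>A\<^esub> x) = a \<otimes>\<^bsub>K\<^esub> f x"
  shows "f \<in> carrier D"
  unfolding dual_carrier_simp dual_carrier_def PiE_iff using assms by blast

lemma dual_eqI:
  assumes "f \<in> carrier D" "g \<in> carrier D" "\<And>a. a \<in> carrier A \<Longrightarrow> f a = g a"
  shows "f = g"
  using assms(1,2) unfolding dual_carrier_simp dual_carrier_def mem_Collect_eq
  by (elim conjE) (erule PiE_ext, assumption, rule assms(3))

lemma dual_zero_closed [simp]: "\<zero>\<^bsub>D\<^esub> \<in> carrier D"
  by (rule dual_memI) (auto simp: dual_bimodule_def)

lemma dual_add_closed [simp]: "\<lbrakk>f \<in> carrier D; g \<in> carrier D\<rbrakk> \<Longrightarrow> f \<oplus>\<^bsub>D\<^esub> g \<in> carrier D"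
  by (rule dual_memI) (simp_all add: K.a_ac K.r_distr, simp add: dual_bimodule_def)

lemma dual_left_closed [simp]: "\<lbrakk>r \<in> carrier A; f \<in> carrier D\<rbrakk> \<Longrightarrow> r \<odot>\<^bsub>D\<^esub> f \<in> carrier D"
  by (rule dual_memI) (simp_all add: A.l_distr smult_mult_left, simp add: dual_bimodule_def)

lemma dual_right_closed [simp]: "\<lbrakk>r \<in> carrier A; f \<in> carrier D\<rbrakk> \<Longrightarrow> rsmult D f r \<in> carrier D"
  by (rule dual_memI) (simp_all add: A.r_distr smult_mult_right, simp add: dual_bimodule_def)

text \<open>The scalar action on the dual. The record \<open>dual_bimodule\<close> offers only the
  two actions of the algebra, and this is the formula that the semitrivial extension uses in its
  second component.\<close>

definition dsmult :: "'a \<Rightarrow> ('c \<Rightarrow> 'a) \<Rightarrow> ('c \<Rightarrow> 'a)" where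
  "dsmult k f = (\<lambda>a\<in>carrier A. k \<otimes>\<^bsub>K\<^esub> f a)"

lemma dsmult_apply [simp]: "a \<in> carrier A \<Longrightarrow> dsmult k f a = k \<otimes>\<^bsub>K\<^esub> f a"
  by (simp add: dsmult_def)

lemma dsmult_closed [simp]: "\<lbrakk>k \<in> carrier K; f \<in> carrier D\<rbrakk> \<Longrightarrow> dsmult k f \<in> carrier D"
  by (rule dual_memI) (simp_all add: K.r_distr K.m_lcomm, simp add: dsmult_def)

text \<open>Scalars act through the multiples \<open>k 1\<close> of the unit. A map compatible with
  the action of the algebra is therefore automatically \<open>K\<close>-linear, which is how
  linearity is obtained for \<open>pairing\<close> and for candidate Frobenius isomorphisms.\<close>

lemma dsmult_eq_left:
  "\<lbrakk>k \<in> carrier K; f \<in> carrier D\<rbrakk> \<Longrightarrow> dsmult k f = (k \<odot>\<^bsub>A\<^esub> \<one>\<^bsub>A\<^esub>) \<odot>\<^bsub>D\<^esub> f"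
  by (rule dual_eqI) (simp_all add: smult_mult_right)

lemma dsmult_eq_right:
  "\<lbrakk>k \<in> carrier K; f \<in> carrier D\<rbrakk> \<Longrightarrow> dsmult k f = rsmult D f (k \<odot>\<^bsub>A\<^esub> \<one>\<^bsub>A\<^esub>)"
  by (rule dual_eqI) (simp_all add: smult_mult_left)

lemma dual_abelian_group: "abelian_group D"
proof (rule abelian_groupI)
  fix f assume f: "f \<in> carrier D"
  have "dsmult (\<ominus>\<^bsub>K\<^esub> \<one>\<^bsub>K\<^esub>) f \<oplus>\<^bsub>D\<^esub> f = \<zero>\<^bsub>D\<^esub>"
    by (rule dual_eqI) (simp_all add: f K.l_minus K.l_neg)
  then show "\<exists>g\<in>carrier D. g \<oplus>\<^bsub>D\<^esub> f = \<zero>\<^bsub>D\<^esub>"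
    using f by (intro bexI[of _ "dsmult (\<ominus>\<^bsub>K\<^esub> \<one>\<^bsub>K\<^esub>) f"]) simp_all
qed (auto intro!: dual_eqI simp: K.a_ac)

lemma dual_ring_bimodule: "ring_bimodule A D"
proof -
  interpret D: abelian_group D by (rule dual_abelian_group)
  show ?thesis
    by unfold_locales (auto intro!: dual_eqI simp: A.l_distr A.r_distr A.m_assoc)
qed

sublocale D: ring_bimodule A D
  by (rule dual_ring_bimodule)

lemma dual_finsum:
  assumes "finite J" "v \<in> J \<rightarrow> carrier A" "f \<in> carrier D"
  shows "f (\<Oplus>\<^bsub>A\<^esub>i\<in>J. v i) = (\<Oplus>\<^bsub>K\<^esub>i\<in>J. f (v i))"
  using assms(1,2)
  by (induction J) (simp_all add: assms(3) Pi_iff)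

lemma finsum_dual_apply:
  assumes "finite J" "v \<in> J \<rightarrow> carrier D" "a \<in> carrier A"
  shows "(\<Oplus>\<^bsub>D\<^esub>i\<in>J. v i) a = (\<Oplus>\<^bsub>K\<^esub>i\<in>J. v i a)"
  using assms(1,2)
  by (induction J) (simp_all add: assms(3) Pi_iff)

end

text \<open>Spanning is phrased as an induction principle, so that applications need not manipulate
  linear combinations. The proof instantiates it with the predicate of being a linear combination of
  \<open>S\<close>, which is closed under the required operations.\<close>

lemma fd_algebraI:
  assumes "field_algebra K A" and fin: "finite S" and S: "S \<subseteq> carrier A"
    and span: "\<And>x P. \<lbrakk>x \<in> carrier A; P \<zero>\<^bsub>A\<^esub>; \<And>s. s \<in> S \<Longrightarrow> P s;
      \<And>x y. \<lbrakk>x \<in> carrier A; y \<in> carrier A; P x; P y\<rbrakk> \<Longrightarrow> P (x \<oplus>\<^bsub>A\<^esub> y);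
      \<And>k x. \<lbrakk>k \<in> carrier K; x \<in> carrier A; P x\<rbrakk> \<Longrightarrow> P (k \<odot>\<^bsub>A\<^esub> x)\<rbrakk> \<Longrightarrow> P x"
  shows "fd_algebra K A"
proof -
  interpret field_algebra K A by fact
  let ?P = "\<lambda>x. \<exists>c \<in> S \<rightarrow> carrier K. x = (\<Oplus>\<^bsub>A\<^esub>s\<in>S. c s \<odot>\<^bsub>A\<^esub> s)"
  have "?P x" if "x \<in> carrier A" for x
  proof (rule span[OF that])
    have "(\<Oplus>\<^bsub>A\<^esub>s\<in>S. \<zero>\<^bsub>K\<^esub> \<odot>\<^bsub>A\<^esub> s) = (\<Oplus>\<^bsub>A\<^esub>s\<in>S. \<zero>\<^bsub>A\<^esub>)"
      using S by (intro M.finsum_cong') auto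
    then show "?P \<zero>\<^bsub>A\<^esub>"
      by (intro bexI[of _ "\<lambda>_. \<zero>\<^bsub>K\<^esub>"]) auto
  next
    fix s assume s: "s \<in> S"
    let ?c = "\<lambda>t. if s = t then \<one>\<^bsub>K\<^esub> else \<zero>\<^bsub>K\<^esub>"
    have "(\<Oplus>\<^bsub>A\<^esub>t\<in>S. ?c t \<odot>\<^bsub>A\<^esub> t) = (\<Oplus>\<^bsub>A\<^esub>t\<in>S. if s = t then t else \<zero>\<^bsub>A\<^esub>)"
      using S by (intro M.finsum_cong') auto
    also have "\<dots> = s"
      using S s fin by (intro M.finsum_singleton) auto
    finally show "?P s"
      by (intro bexI[of _ ?c]) auto
  next
    fix x y assume "?P x" "?P y"
    then obtain c c' where c: "c \<in> S \<rightarrow> carrier K" "c' \<in> S \<rightarrow> carrier K"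
      and x: "x = (\<Oplus>\<^bsub>A\<^esub>s\<in>S. c s \<odot>\<^bsub>A\<^esub> s)" and y: "y = (\<Oplus>\<^bsub>A\<^esub>s\<in>S. c' s \<odot>\<^bsub>A\<^esub> s)"
      by blast
    have "x \<oplus>\<^bsub>A\<^esub> y = (\<Oplus>\<^bsub>A\<^esub>s\<in>S. c s \<odot>\<^bsub>A\<^esub> s \<oplus>\<^bsub>A\<^esub> c' s \<odot>\<^bsub>A\<^esub> s)"
      unfolding x y using c S by (intro M.finsum_addf[symmetric]) auto
    also have "\<dots> = (\<Oplus>\<^bsub>A\<^esub>s\<in>S. (c s \<oplus>\<^bsub>K\<^esub> c' s) \<odot>\<^bsub>A\<^esub> s)"
      using c S by (intro M.finsum_cong') (auto simp: Pi_iff subset_iff smult_l_distr)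
    finally show "?P (x \<oplus>\<^bsub>A\<^esub> y)"
      using c by (intro bexI[of _ "\<lambda>s. c s \<oplus>\<^bsub>K\<^esub> c' s"]) auto
  next
    fix k x assume k: "k \<in> carrier K" and "?P x"
    then obtain c where c: "c \<in> S \<rightarrow> carrier K" and x: "x = (\<Oplus>\<^bsub>A\<^esub>s\<in>S. c s \<odot>\<^bsub>A\<^esub> s)"
      by blast
    have "k \<odot>\<^bsub>A\<^esub> x = (\<Oplus>\<^bsub>A\<^esub>s\<in>S. k \<odot>\<^bsub>A\<^esub> (c s \<odot>\<^bsub>A\<^esub> s))"
      unfolding x using c S k fin by (intro finsum_smult_ldistr) auto
    also have "\<dots> = (\<Oplus>\<^bsub>A\<^esub>s\<in>S. (k \<otimes>\<^bsub>K\<^esub> c s) \<odot>\<^bsub>A\<^esub> s)"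
      using c S k by (intro M.finsum_cong') (auto simp: Pi_iff subset_iff smult_assoc1)
    finally show "?P (k \<odot>\<^bsub>A\<^esub> x)"
      using c k by (intro bexI[of _ "\<lambda>s. k \<otimes>\<^bsub>K\<^esub> c s"]) auto
  qed
  then show ?thesis
    using fin S by unfold_locales blast
qed

section \<open>Algebras with a finite basis and its dual basis\<close>

locale based_algebra = field_algebra K A
  for K :: "('k, 'x) ring_scheme" (structure) and A :: "('k, 'a, 'y) module_scheme" (structure) +
  fixes I :: "'i set" and u :: "'i \<Rightarrow> 'a" and d :: "'i \<Rightarrow> 'a \<Rightarrow> 'k"
  assumes finite_index: "finite I"
    and basis_closed: "i \<in> I \<Longrightarrow> u i \<in> carrier A"
    and coord_closed: "i \<in> I \<Longrightarrow> d i \<in> carrier (dual_bimodule K A)"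
    and coord_basis: "\<lbrakk>i \<in> I; j \<in> I\<rbrakk> \<Longrightarrow> d i (u j) = (if i = j then \<one>\<^bsub>K\<^esub> else \<zero>\<^bsub>K\<^esub>)"
    and expansion: "x \<in> carrier A \<Longrightarrow> x = (\<Oplus>\<^bsub>A\<^esub>i\<in>I. d i x \<odot>\<^bsub>A\<^esub> u i)"
begin

text \<open>Reduces linear statements to basis vectors: the predicate is propagated along the
  partial sums of \<open>expansion\<close>, whence the detour through subsets \<open>J\<close> of
  the index set.\<close>

lemma basis_induct [consumes 1, case_names zero basis add smult]:
  assumes x: "x \<in> carrier A" and zero: "P \<zero>\<^bsub>A\<^esub>" and basis: "\<And>i. i \<in> I \<Longrightarrow> P (u i)"
    and add: "\<And>x y. \<lbrakk>x \<in> carrier A; y \<in> carrier A; P x; P y\<rbrakk> \<Longrightarrow> P (x \<oplus>\<^bsub>A\<^esub> y)"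
    and smult: "\<And>k x. \<lbrakk>k \<in> carrier K; x \<in> carrier A; P x\<rbrakk> \<Longrightarrow> P (k \<odot>\<^bsub>A\<^esub> x)"
  shows "P x"
proof -
  have "P (\<Oplus>\<^bsub>A\<^esub>i\<in>J. d i x \<odot>\<^bsub>A\<^esub> u i)" if "J \<subseteq> I" for J
    using finite_subset[OF that finite_index] that
  proof (induction J)
    case empty
    then show ?case using zero by simp
  next
    case (insert j J)
    then have "(\<lambda>i. d i x \<odot>\<^bsub>A\<^esub> u i) \<in> J \<rightarrow> carrier A" "d j x \<odot>\<^bsub>A\<^esub> u j \<in> carrier A"
      using basis_closed coord_closed x by auto
    then show ?case
      using insert x basis_closed coord_closed
      by (simp add: add smult basis)
  qed
  then have "P (\<Oplus>\<^bsub>A\<^esub>i\<in>I. d i x \<odot>\<^bsub>A\<^esub> u i)" by simp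
  then show ?thesis using expansion[OF x] by simp
qed

text \<open>The coefficients of a functional in the dual basis are its values on the basis, as
  follows by applying it to the expansion of its argument.\<close>

lemma dual_expansion:
  assumes f: "f \<in> carrier D"
  shows "f = (\<Oplus>\<^bsub>D\<^esub>i\<in>I. dsmult (f (u i)) (d i))"
proof (rule dual_eqI[OF f])
  show "(\<Oplus>\<^bsub>D\<^esub>i\<in>I. dsmult (f (u i)) (d i)) \<in> carrier D"
    using f basis_closed coord_closed by (intro D.M.finsum_closed) auto
next
  fix a assume a: "a \<in> carrier A"
  have "f a = f (\<Oplus>\<^bsub>A\<^esub>i\<in>I. d i a \<odot>\<^bsub>A\<^esub> u i)"
    using expansion[OF a] by simp
  also have "\<dots> = (\<Oplus>\<^bsub>K\<^esub>i\<in>I. f (d i a \<odot>\<^bsub>A\<^esub> u i))"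
    using a f basis_closed coord_closed finite_index by (intro dual_finsum) auto
  also have "\<dots> = (\<Oplus>\<^bsub>K\<^esub>i\<in>I. dsmult (f (u i)) (d i) a)"
    using a f basis_closed coord_closed
    by (intro K.finsum_cong') (auto simp: K.m_comm)
  also have "\<dots> = (\<Oplus>\<^bsub>D\<^esub>i\<in>I. dsmult (f (u i)) (d i)) a"
    using a f basis_closed coord_closed finite_index
    by (intro finsum_dual_apply[symmetric]) auto
  finally show "f a = (\<Oplus>\<^bsub>D\<^esub>i\<in>I. dsmult (f (u i)) (d i)) a" .
qed

lemma dual_induct [consumes 1, case_names zero basis add smult]:
  assumes f: "f \<in> carrier D" and zero: "P \<zero>\<^bsub>D\<^esub>" and basis: "\<And>i. i \<in> I \<Longrightarrow> P (d i)"
    and add: "\<And>f g. \<lbrakk>f \<in> carrier D; g \<in> carrier D; P f; P g\<rbrakk> \<Longrightarrow> P (f \<oplus>\<^bsub>D\<^esub> g)"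
    and smult: "\<And>k f. \<lbrakk>k \<in> carrier K; f \<in> carrier D; P f\<rbrakk> \<Longrightarrow> P (dsmult k f)"
  shows "P f"
proof -
  have "P (\<Oplus>\<^bsub>D\<^esub>i\<in>J. dsmult (f (u i)) (d i))" if "J \<subseteq> I" for J
    using finite_subset[OF that finite_index] that
  proof (induction J)
    case empty
    then show ?case using zero by simp
  next
    case (insert j J)
    then have "(\<lambda>i. dsmult (f (u i)) (d i)) \<in> J \<rightarrow> carrier D"
      using basis_closed coord_closed f by auto
    then show ?case
      using insert f basis_closed coord_closed
      by (simp add: add smult basis)
  qed
  then have "P (\<Oplus>\<^bsub>D\<^esub>i\<in>I. dsmult (f (u i)) (d i))" by simp
  then show ?thesis using dual_expansion[OF f] by simp
qed

lemma dual_eq_if_basis_eq: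
  assumes f: "f \<in> carrier D" and g: "g \<in> carrier D" and eq: "\<And>i. i \<in> I \<Longrightarrow> f (u i) = g (u i)"
  shows "f = g"
proof (rule dual_eqI[OF f g])
  fix a assume "a \<in> carrier A"
  then show "f a = g a"
    by (induction a rule: basis_induct) (simp_all add: f g eq)
qed

text \<open>Coordinates determine an element through \<open>expansion\<close>; this is half of the
  nondegeneracy of \<open>trace_form\<close> below.\<close>

lemma eq_if_dual_eq:
  assumes "x \<in> carrier A" "y \<in> carrier A" "\<And>i. i \<in> I \<Longrightarrow> d i x = d i y"
  shows "x = y"
proof -
  have "(\<Oplus>\<^bsub>A\<^esub>i\<in>I. d i x \<odot>\<^bsub>A\<^esub> u i) = (\<Oplus>\<^bsub>A\<^esub>i\<in>I. d i y \<odot>\<^bsub>A\<^esub> u i)"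
    using assms basis_closed coord_closed by (intro M.finsum_cong') auto
  then show ?thesis using expansion assms by metis
qed

end


section \<open>Semitrivial extensions\<close>

locale semitrivial_pairing = field_algebra K A
  for K :: "('k, 'x) ring_scheme" (structure) and A :: "('k, 'a, 'y) module_scheme" (structure) +
  fixes \<phi> :: "(('a \<Rightarrow> 'k) \<times> ('a \<Rightarrow> 'k) \<Rightarrow>\<^sub>0 int) set \<Rightarrow> 'a"
  assumes iso: "\<phi> \<in> bimodule_isos A
      (tensor_bimodule A (dual_bimodule K A) (dual_bimodule K A)) (regular_bimodule A)"
begin

sublocale DD: bimodule_tensor A D D
  by unfold_locales

text \<open>The balanced biadditive map induced by \<open>\<phi>\<close>. From here on cosets are
  left behind: what is needed of \<open>\<phi>\<close> is expressed by the algebraic rules for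
  \<open>pairing\<close> and by \<open>pairing_generate\<close>.\<close>

definition pairing :: "('a \<Rightarrow> 'k) \<Rightarrow> ('a \<Rightarrow> 'k) \<Rightarrow> 'a" where
  "pairing f g = \<phi> (pure_tensor A D D f g)"

lemma iso_bij: "bij_betw \<phi> (carrier DD.T) (carrier A)"
  using iso by (simp add: bimodule_isos_def left_module_isos_def regular_bimodule_def)

lemma iso_closed: "U \<in> carrier DD.T \<Longrightarrow> \<phi> U \<in> carrier A"
  using iso_bij by (auto simp: bij_betw_def)

lemma iso_add:
  "\<lbrakk>U \<in> carrier DD.T; V \<in> carrier DD.T\<rbrakk> \<Longrightarrow> \<phi> (U \<oplus>\<^bsub>DD.T\<^esub> V) = \<phi> U \<oplus>\<^bsub>A\<^esub> \<phi> V"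
  using iso by (simp add: bimodule_isos_def left_module_isos_def regular_bimodule_def)

lemma iso_smult:
  "\<lbrakk>r \<in> carrier A; U \<in> carrier DD.T\<rbrakk> \<Longrightarrow> \<phi> (r \<odot>\<^bsub>DD.T\<^esub> U) = r \<otimes>\<^bsub>A\<^esub> \<phi> U"
  using iso by (simp add: bimodule_isos_def left_module_isos_def regular_bimodule_def)

lemma iso_rsmult:
  "\<lbrakk>r \<in> carrier A; U \<in> carrier DD.T\<rbrakk> \<Longrightarrow> \<phi> (rsmult DD.T U r) = \<phi> U \<otimes>\<^bsub>A\<^esub> r"
  using iso by (simp add: bimodule_isos_def left_module_isos_def regular_bimodule_def)

lemma pairing_closed [simp]: "\<lbrakk>f \<in> carrier D; g \<in> carrier D\<rbrakk> \<Longrightarrow> pairing f g \<in> carrier A"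
  unfolding pairing_def by (intro iso_closed DD.pure_carrier)

lemma pairing_add_left:
  "\<lbrakk>f \<in> carrier D; f' \<in> carrier D; g \<in> carrier D\<rbrakk>
    \<Longrightarrow> pairing (f \<oplus>\<^bsub>D\<^esub> f') g = pairing f g \<oplus>\<^bsub>A\<^esub> pairing f' g"
  unfolding pairing_def by (simp add: DD.pure_add_left iso_add DD.pure_carrier)

lemma pairing_add_right:
  "\<lbrakk>f \<in> carrier D; g \<in> carrier D; g' \<in> carrier D\<rbrakk>
    \<Longrightarrow> pairing f (g \<oplus>\<^bsub>D\<^esub> g') = pairing f g \<oplus>\<^bsub>A\<^esub> pairing f g'"
  unfolding pairing_def by (simp add: DD.pure_add_right iso_add DD.pure_carrier)

lemma pairing_balanced:
  "\<lbrakk>f \<in> carrier D; r \<in> carrier A; g \<in> carrier D\<rbrakk>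
    \<Longrightarrow> pairing (rsmult D f r) g = pairing f (r \<odot>\<^bsub>D\<^esub> g)"
  unfolding pairing_def by (simp add: DD.pure_balanced)

lemma pairing_left:
  "\<lbrakk>f \<in> carrier D; r \<in> carrier A; g \<in> carrier D\<rbrakk>
    \<Longrightarrow> pairing (r \<odot>\<^bsub>D\<^esub> f) g = r \<otimes>\<^bsub>A\<^esub> pairing f g"
  unfolding pairing_def by (simp add: DD.smult_pure[symmetric] iso_smult DD.pure_carrier)

lemma pairing_right:
  "\<lbrakk>f \<in> carrier D; r \<in> carrier A; g \<in> carrier D\<rbrakk>
    \<Longrightarrow> pairing f (rsmult D g r) = pairing f g \<otimes>\<^bsub>A\<^esub> r"
  unfolding pairing_def by (simp add: DD.rsmult_pure[symmetric] iso_rsmult DD.pure_carrier)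

lemma pairing_dsmult_left:
  "\<lbrakk>f \<in> carrier D; k \<in> carrier K; g \<in> carrier D\<rbrakk>
    \<Longrightarrow> pairing (dsmult k f) g = k \<odot>\<^bsub>A\<^esub> pairing f g"
  by (simp add: dsmult_eq_left pairing_left smult_mult_left)

lemma pairing_dsmult_right:
  "\<lbrakk>f \<in> carrier D; k \<in> carrier K; g \<in> carrier D\<rbrakk>
    \<Longrightarrow> pairing f (dsmult k g) = k \<odot>\<^bsub>A\<^esub> pairing f g"
  by (simp add: dsmult_eq_right pairing_right smult_mult_right)

lemma pairing_zero_left [simp]: "g \<in> carrier D \<Longrightarrow> pairing \<zero>\<^bsub>D\<^esub> g = \<zero>\<^bsub>A\<^esub>"
  using pairing_add_left[of "\<zero>\<^bsub>D\<^esub>" "\<zero>\<^bsub>D\<^esub>" g] by simp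

lemma pairing_zero_right [simp]: "f \<in> carrier D \<Longrightarrow> pairing f \<zero>\<^bsub>D\<^esub> = \<zero>\<^bsub>A\<^esub>"
  using pairing_add_right[of f "\<zero>\<^bsub>D\<^esub>" "\<zero>\<^bsub>D\<^esub>"] by simp

text \<open>This is where surjectivity of \<open>\<phi>\<close> enters. It provides strong
  gradedness in the case of two factors of nontrivial degree.\<close>

lemma pairing_generate:
  assumes "r \<in> carrier A"
  shows "r \<in> generate (add_monoid A) {pairing f g | f g. f \<in> carrier D \<and> g \<in> carrier D}"
proof -
  obtain U where "U \<in> carrier DD.T" "r = \<phi> U"
    using assms iso_bij by (auto simp: bij_betw_def)
  then show ?thesis
    using DD.additive_image_generate[OF M.abelian_group_axioms iso_closed iso_add, of U]
    by (simp add: pairing_def)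
qed

abbreviation "S \<equiv> semitrivial_extension K A \<phi>"

lemma ext_simps:
  "carrier S = carrier A \<times> carrier D"
  "(r, f) \<otimes>\<^bsub>S\<^esub> (s, g) = (r \<otimes>\<^bsub>A\<^esub> s \<oplus>\<^bsub>A\<^esub> pairing f g, r \<odot>\<^bsub>D\<^esub> g \<oplus>\<^bsub>D\<^esub> rsmult D f s)"
  "\<one>\<^bsub>S\<^esub> = (\<one>\<^bsub>A\<^esub>, \<zero>\<^bsub>D\<^esub>)"
  "\<zero>\<^bsub>S\<^esub> = (\<zero>\<^bsub>A\<^esub>, \<zero>\<^bsub>D\<^esub>)"
  "(r, f) \<oplus>\<^bsub>S\<^esub> (s, g) = (r \<oplus>\<^bsub>A\<^esub> s, f \<oplus>\<^bsub>D\<^esub> g)"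
  "k \<odot>\<^bsub>S\<^esub> (r, f) = (k \<odot>\<^bsub>A\<^esub> r, dsmult k f)"
  by (simp_all add: semitrivial_extension_def Let_def pairing_def dsmult_def)

lemma dual_left_zero [simp]:
  "r \<in> carrier A \<Longrightarrow> r \<odot>\<^bsub>D\<^esub> \<zero>\<^bsub>D\<^esub> = \<zero>\<^bsub>D\<^esub>" "f \<in> carrier D \<Longrightarrow> \<zero>\<^bsub>A\<^esub> \<odot>\<^bsub>D\<^esub> f = \<zero>\<^bsub>D\<^esub>"
  "r \<in> carrier A \<Longrightarrow> rsmult D \<zero>\<^bsub>D\<^esub> r = \<zero>\<^bsub>D\<^esub>" "f \<in> carrier D \<Longrightarrow> rsmult D f \<zero>\<^bsub>A\<^esub> = \<zero>\<^bsub>D\<^esub>"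
  "k \<in> carrier K \<Longrightarrow> dsmult k \<zero>\<^bsub>D\<^esub> = \<zero>\<^bsub>D\<^esub>"
  by (auto intro!: dual_eqI)

lemma ext_abelian_group: "abelian_group S"
proof (rule abelian_groupI)
  fix x assume "x \<in> carrier S"
  then obtain r f where x: "x = (r, f)" "r \<in> carrier A" "f \<in> carrier D"
    by (auto simp: ext_simps)
  then show "\<exists>y\<in>carrier S. y \<oplus>\<^bsub>S\<^esub> x = \<zero>\<^bsub>S\<^esub>"
    by (intro bexI[of _ "(\<ominus>\<^bsub>A\<^esub> r, \<ominus>\<^bsub>D\<^esub> f)"])
      (simp_all add: ext_simps M.l_neg D.M.l_neg)
qed (auto simp: ext_simps M.a_ac D.M.a_ac)

end

section \<open>Extensions by an associative pairing\<close>

locale semitrivial = semitrivial_pairing K A \<phi>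
  for K :: "('k, 'x) ring_scheme" (structure) and A :: "('k, 'a, 'y) module_scheme" (structure)
    and \<phi> +
  assumes pairing_assoc: "\<lbrakk>f \<in> carrier D; g \<in> carrier D; h \<in> carrier D\<rbrakk>
    \<Longrightarrow> pairing f g \<odot>\<^bsub>D\<^esub> h = rsmult D f (pairing g h)"
begin

text \<open>The first components agree by biadditivity, balance and compatibility of
  \<open>pairing\<close> with the actions. In the second components the bimodule laws match all
  terms except \<open>pairing f g\<close> acting on \<open>h\<close> and \<open>f\<close> acted on
  by \<open>pairing g h\<close>; these are identified by \<open>pairing_assoc\<close>.\<close>

lemma ext_mult_assoc:
  assumes "r \<in> carrier A" "s \<in> carrier A" "t \<in> carrier A"
    and "f \<in> carrier D" "g \<in> carrier D" "h \<in> carrier D"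
  shows "((r, f) \<otimes>\<^bsub>S\<^esub> (s, g)) \<otimes>\<^bsub>S\<^esub> (t, h) = (r, f) \<otimes>\<^bsub>S\<^esub> ((s, g) \<otimes>\<^bsub>S\<^esub> (t, h))"
proof -
  have "(r \<otimes>\<^bsub>A\<^esub> s \<oplus>\<^bsub>A\<^esub> pairing f g) \<otimes>\<^bsub>A\<^esub> t \<oplus>\<^bsub>A\<^esub> pairing (r \<odot>\<^bsub>D\<^esub> g \<oplus>\<^bsub>D\<^esub> rsmult D f s) h
    = r \<otimes>\<^bsub>A\<^esub> (s \<otimes>\<^bsub>A\<^esub> t \<oplus>\<^bsub>A\<^esub> pairing g h) \<oplus>\<^bsub>A\<^esub> pairing f (s \<odot>\<^bsub>D\<^esub> h \<oplus>\<^bsub>D\<^esub> rsmult D g t)"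
    using assms
    by (simp add: pairing_add_left pairing_add_right pairing_left pairing_right pairing_balanced
        A.l_distr A.r_distr A.m_assoc M.a_ac)
  moreover have "(r \<otimes>\<^bsub>A\<^esub> s \<oplus>\<^bsub>A\<^esub> pairing f g) \<odot>\<^bsub>D\<^esub> h \<oplus>\<^bsub>D\<^esub> rsmult D (r \<odot>\<^bsub>D\<^esub> g \<oplus>\<^bsub>D\<^esub> rsmult D f s) t
    = r \<odot>\<^bsub>D\<^esub> (s \<odot>\<^bsub>D\<^esub> h \<oplus>\<^bsub>D\<^esub> rsmult D g t) \<oplus>\<^bsub>D\<^esub> rsmult D f (s \<otimes>\<^bsub>A\<^esub> t \<oplus>\<^bsub>A\<^esub> pairing g h)"
    using assms
    by (simp add: D.left_add D.right_add D.left_add_scalar D.right_add_scalar D.left_mult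
        D.right_mult D.left_right pairing_assoc D.M.a_ac)
  ultimately show ?thesis
    by (simp only: ext_simps)
qed

lemma ext_field_algebra: "field_algebra K S"
proof -
  interpret S: abelian_group S by (rule ext_abelian_group)
  have ring: "ring S"
  proof (rule ringI)
    show "Group.monoid S"
    proof (rule monoidI)
      fix x y z assume "x \<in> carrier S" "y \<in> carrier S" "z \<in> carrier S"
      then show "(x \<otimes>\<^bsub>S\<^esub> y) \<otimes>\<^bsub>S\<^esub> z = x \<otimes>\<^bsub>S\<^esub> (y \<otimes>\<^bsub>S\<^esub> z)"
        by (cases x; cases y; cases z) (simp only: ext_simps(1) mem_Sigma_iff ext_mult_assoc)
    qed (auto simp: ext_simps D.left_one D.right_one)
  next
    fix x y z assume "x \<in> carrier S" "y \<in> carrier S" "z \<in> carrier S"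
    then show "(x \<oplus>\<^bsub>S\<^esub> y) \<otimes>\<^bsub>S\<^esub> z = x \<otimes>\<^bsub>S\<^esub> z \<oplus>\<^bsub>S\<^esub> y \<otimes>\<^bsub>S\<^esub> z"
      "z \<otimes>\<^bsub>S\<^esub> (x \<oplus>\<^bsub>S\<^esub> y) = z \<otimes>\<^bsub>S\<^esub> x \<oplus>\<^bsub>S\<^esub> z \<otimes>\<^bsub>S\<^esub> y"
      by (auto simp: ext_simps pairing_add_left pairing_add_right A.l_distr A.r_distr M.a_ac
          D.left_add D.right_add D.left_add_scalar D.right_add_scalar D.M.a_ac)
  qed (rule ext_abelian_group)
  have module: "Module.module K S"
    by (rule moduleI[OF K.is_cring ext_abelian_group])
      (auto simp: ext_simps smult_l_distr smult_r_distr smult_assoc1 K.l_distr K.r_distr K.m_assoc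
        intro!: dual_eqI)
  have "k \<odot>\<^bsub>S\<^esub> x \<otimes>\<^bsub>S\<^esub> y = k \<odot>\<^bsub>S\<^esub> (x \<otimes>\<^bsub>S\<^esub> y) \<and> x \<otimes>\<^bsub>S\<^esub> (k \<odot>\<^bsub>S\<^esub> y) = k \<odot>\<^bsub>S\<^esub> (x \<otimes>\<^bsub>S\<^esub> y)"
    if k: "k \<in> carrier K" and xy: "x \<in> carrier S" "y \<in> carrier S" for k x y
  proof -
    obtain r f s g where xy: "x = (r, f)" "y = (s, g)"
      and c: "r \<in> carrier A" "s \<in> carrier A" "f \<in> carrier D" "g \<in> carrier D"
      using xy by (auto simp: ext_simps)
    have "(k \<odot>\<^bsub>A\<^esub> r) \<odot>\<^bsub>D\<^esub> g \<oplus>\<^bsub>D\<^esub> rsmult D (dsmult k f) s = dsmult k (r \<odot>\<^bsub>D\<^esub> g \<oplus>\<^bsub>D\<^esub> rsmult D f s)"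
      "r \<odot>\<^bsub>D\<^esub> dsmult k g \<oplus>\<^bsub>D\<^esub> rsmult D f (k \<odot>\<^bsub>A\<^esub> s) = dsmult k (r \<odot>\<^bsub>D\<^esub> g \<oplus>\<^bsub>D\<^esub> rsmult D f s)"
      using c k by (auto intro!: dual_eqI simp: smult_mult_left smult_mult_right K.r_distr)
    then show ?thesis
      using c k
      by (simp add: xy ext_simps pairing_dsmult_left pairing_dsmult_right smult_mult_left
          smult_mult_right smult_r_distr)
  qed
  then show ?thesis
    using ring module K.field_axioms
    by (intro field_algebra.intro field_algebra_axioms.intro) auto
qed

sublocale S: field_algebra K S
  by (rule ext_field_algebra)

section \<open>The grading by the group of order two\<close>

abbreviation "grading \<equiv> semitrivial_grading K A"

lemma grading_simps:
  "grading 0 = carrier A \<times> {\<zero>\<^bsub>D\<^esub>}" "grading 1 = {\<zero>\<^bsub>A\<^esub>} \<times> carrier D"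
  by (simp_all add: semitrivial_grading_def)

lemma carrier_C2: "carrier C2 = {0, 1}"
  by (auto simp: carrier_integer_mod_group)

lemma ext_minus: "\<lbrakk>r \<in> carrier A; f \<in> carrier D\<rbrakk> \<Longrightarrow> \<ominus>\<^bsub>S\<^esub> (r, f) = (\<ominus>\<^bsub>A\<^esub> r, \<ominus>\<^bsub>D\<^esub> f)"
  by (rule S.M.minus_equality) (simp_all add: ext_simps M.l_neg D.M.l_neg)

lemma grading_submodule: "g \<in> carrier C2 \<Longrightarrow> submodule (grading g) K S"
  by (rule S.submoduleI) (auto simp: carrier_C2 grading_simps ext_simps ext_minus)

lemma grading_mult:
  assumes "g \<in> carrier C2" "h \<in> carrier C2" "x \<in> grading g" "y \<in> grading h"
  shows "x \<otimes>\<^bsub>S\<^esub> y \<in> grading (g \<otimes>\<^bsub>C2\<^esub> h)"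
  using assms by (auto simp: carrier_C2 grading_simps ext_simps)

text \<open>The definition of a grading sums over the support of the family only; the omitted terms
  are zero, so the sum may be taken over both degrees.\<close>

lemma grading_finsum:
  assumes "v \<in> (\<Pi>\<^sub>E g\<in>carrier C2. grading g)"
  shows "(\<Oplus>\<^bsub>S\<^esub>g\<in>{g \<in> carrier C2. v g \<noteq> \<zero>\<^bsub>S\<^esub>}. v g) = v 0 \<oplus>\<^bsub>S\<^esub> v 1"
proof -
  have v: "v 0 \<in> carrier S" "v 1 \<in> carrier S"
    using assms by (auto simp: carrier_C2 ext_simps grading_simps PiE_iff)
  have "(\<Oplus>\<^bsub>S\<^esub>g\<in>{g \<in> carrier C2. v g \<noteq> \<zero>\<^bsub>S\<^esub>}. v g) = (\<Oplus>\<^bsub>S\<^esub>g\<in>carrier C2. v g)"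
    using v by (intro S.M.add.finprod_mono_neutral_cong_left) (auto simp: carrier_C2)
  also have "\<dots> = v 0 \<oplus>\<^bsub>S\<^esub> v 1"
    using v by (simp add: carrier_C2)
  finally show ?thesis .
qed

lemma ext_graded: "graded_algebra K C2 S grading"
  unfolding graded_algebra_def
proof (intro conjI ballI)
  fix x assume "x \<in> carrier S"
  then obtain r f where x: "x = (r, f)" "r \<in> carrier A" "f \<in> carrier D"
    by (auto simp: ext_simps)
  \<comment> \<open>The family of homogeneous components of \<open>(r, f)\<close>. Restricting it to
    the carrier of \<open>C2\<close> makes it extensional, as uniqueness in the product
    \<open>\<Pi>\<^sub>E\<close> demands.\<close>
  define w where "w = (\<lambda>g\<in>carrier C2. if g = 0 then (r, \<zero>\<^bsub>D\<^esub>) else (\<zero>\<^bsub>A\<^esub>, f))"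
  have w: "w \<in> (\<Pi>\<^sub>E g\<in>carrier C2. grading g)"
    using x by (auto simp: w_def carrier_C2 grading_simps)
  have fin: "finite {g \<in> carrier C2. v g \<noteq> \<zero>\<^bsub>S\<^esub>}" for v :: "int \<Rightarrow> _"
    by (simp add: carrier_C2)
  show "\<exists>!v. v \<in> (\<Pi>\<^sub>E g\<in>carrier C2. grading g) \<and> finite {g \<in> carrier C2. v g \<noteq> \<zero>\<^bsub>S\<^esub>} \<and>
      x = (\<Oplus>\<^bsub>S\<^esub>g\<in>{g \<in> carrier C2. v g \<noteq> \<zero>\<^bsub>S\<^esub>}. v g)"
  proof (intro ex1I[of _ w] conjI w fin, goal_cases)
    case 1
    show ?case
      using x by (simp add: grading_finsum[OF w]) (simp add: w_def carrier_C2 ext_simps)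
  next
    case (2 v)
    then have v: "v \<in> (\<Pi>\<^sub>E g\<in>carrier C2. grading g)" and "x = v 0 \<oplus>\<^bsub>S\<^esub> v 1"
      using grading_finsum by auto
    moreover obtain s g where "v 0 = (s, \<zero>\<^bsub>D\<^esub>)" "v 1 = (\<zero>\<^bsub>A\<^esub>, g)" "s \<in> carrier A" "g \<in> carrier D"
      using v by (auto simp: PiE_iff carrier_C2 grading_simps)
    ultimately show ?case
      using x by (intro PiE_ext[OF v w]) (auto simp: w_def carrier_C2 ext_simps)
  qed
qed (simp_all add: ext_field_algebra grading_submodule grading_mult del: mult_integer_mod_group)

text \<open>If one of the degrees is trivial, multiplying by the unit of \<open>S\<close> already
  gives every element. In the remaining case the products are the pairs
  \<open>(pairing f g, 0)\<close>, and \<open>pairing_generate\<close> applies.\<close>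

lemma ext_strongly_graded: "strongly_graded_algebra K C2 S grading"
proof -
  define P where "P g h = {x \<otimes>\<^bsub>S\<^esub> y | x y. x \<in> grading g \<and> y \<in> grading h}" for g h
  have "generate (add_monoid S) (P g h) = grading (g \<otimes>\<^bsub>C2\<^esub> h)"
    if gh: "g \<in> carrier C2" "h \<in> carrier C2" for g h
  proof
    have sub: "subgroup (grading (g \<otimes>\<^bsub>C2\<^esub> h)) (add_monoid S)"
      using grading_submodule[of "g \<otimes>\<^bsub>C2\<^esub> h"] gh group.is_monoid[OF group_integer_mod_group]
      by (meson monoid.m_closed submodule.axioms(1))
    show "generate (add_monoid S) (P g h) \<subseteq> grading (g \<otimes>\<^bsub>C2\<^esub> h)"
      using grading_mult[OF gh] by (intro S.M.add.generate_subgroup_incl[OF _ sub]) (auto simp: P_def)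
    consider "g = 0" | "h = 0" | "g = 1" "h = 1"
      using gh by (auto simp: carrier_C2)
    then show "grading (g \<otimes>\<^bsub>C2\<^esub> h) \<subseteq> generate (add_monoid S) (P g h)"
    proof cases
      case 1
      have "x \<in> P g h" if "x \<in> grading h" for x
      proof -
        have "x \<in> carrier S" "\<one>\<^bsub>S\<^esub> \<in> grading 0"
          using that gh by (auto simp: carrier_C2 grading_simps ext_simps)
        then have "x = \<one>\<^bsub>S\<^esub> \<otimes>\<^bsub>S\<^esub> x" "\<one>\<^bsub>S\<^esub> \<in> grading 0" by simp_all
        then show ?thesis unfolding P_def 1 using that by blast
      qed
      then show ?thesis
        using 1 gh by (auto simp: carrier_C2 intro: generate.incl)
    next
      case 2
      have "x \<in> P g h" if "x \<in> grading g" for x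
      proof -
        have "x \<in> carrier S" "\<one>\<^bsub>S\<^esub> \<in> grading 0"
          using that gh by (auto simp: carrier_C2 grading_simps ext_simps)
        then have "x = x \<otimes>\<^bsub>S\<^esub> \<one>\<^bsub>S\<^esub>" "\<one>\<^bsub>S\<^esub> \<in> grading 0" by simp_all
        then show ?thesis unfolding P_def 2 using that by blast
      qed
      then show ?thesis
        using 2 gh by (auto simp: carrier_C2 intro: generate.incl)
    next
      case 3
      \<comment> \<open>Generation in \<open>A\<close> is carried over to generation in
        \<open>S\<close> along the additive embedding of \<open>A\<close> as the trivial
        component.\<close>
      have "(r, \<zero>\<^bsub>D\<^esub>) \<in> generate (add_monoid S) (P 1 1)"
        if "r \<in> generate (add_monoid A) {pairing f g | f g. f \<in> carrier D \<and> g \<in> carrier D}" for r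
        using that
      proof (induction r)
        case one
        then show ?case
          using generate.one[of "add_monoid S" "P 1 1"] by (simp add: ext_simps)
      next
        have P: "(pairing f g, \<zero>\<^bsub>D\<^esub>) \<in> P 1 1" if "f \<in> carrier D" "g \<in> carrier D" for f g
        proof -
          have "(pairing f g, \<zero>\<^bsub>D\<^esub>) = (\<zero>\<^bsub>A\<^esub>, f) \<otimes>\<^bsub>S\<^esub> (\<zero>\<^bsub>A\<^esub>, g)"
            using that by (simp add: ext_simps)
          then show ?thesis
            using that unfolding P_def grading_simps by blast
        qed
        {
          case (incl r)
          then show ?case
            using P by (auto intro: generate.incl)
        next
          case (inv r)
          then obtain f g where fg: "r = pairing f g" "f \<in> carrier D" "g \<in> carrier D"
            by blast
          have "inv\<^bsub>add_monoid A\<^esub> r = \<ominus>\<^bsub>A\<^esub> r" "inv\<^bsub>add_monoid S\<^esub> (r, \<zero>\<^bsub>D\<^esub>) = \<ominus>\<^bsub>S\<^esub> (r, \<zero>\<^bsub>D\<^esub>)"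
            by (simp_all add: a_inv_def)
          then show ?case
            using generate.inv[OF P[OF fg(2,3)], of "add_monoid S"] fg by (simp add: ext_minus a_inv_def[of D])
        }
      next
        case (eng r s)
        then show ?case
          using generate.eng[OF eng.IH] by (simp add: ext_simps)
      qed
      then show ?thesis
        using 3 pairing_generate by (auto simp: grading_simps)
    qed
  qed
  then show ?thesis
    using ext_graded by (simp add: strongly_graded_algebra_def P_def)
qed

section \<open>The component of trivial degree\<close>

abbreviation "S0 \<equiv> trivial_component C2 S grading"

lemma trivial_component_eq: "S0 = S\<lparr>carrier := carrier A \<times> {\<zero>\<^bsub>D\<^esub>}\<rparr>"
  by (simp add: trivial_component_def grading_simps)

lemma trivial_component_simps:
  "carrier S0 = carrier A \<times> {\<zero>\<^bsub>D\<^esub>}"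
  "x \<oplus>\<^bsub>S0\<^esub> y = x \<oplus>\<^bsub>S\<^esub> y" "x \<otimes>\<^bsub>S0\<^esub> y = x \<otimes>\<^bsub>S\<^esub> y" "k \<odot>\<^bsub>S0\<^esub> x = k \<odot>\<^bsub>S\<^esub> x" "\<zero>\<^bsub>S0\<^esub> = \<zero>\<^bsub>S\<^esub>"
  by (simp_all add: trivial_component_eq)

lemma trivial_component_field_algebra: "field_algebra K S0"
proof -
  have "Module.module K S0"
    unfolding trivial_component_eq
    using grading_submodule[of 0] S.module_axioms submodule.submodule_is_module
    by (fastforce simp: carrier_C2 grading_simps)
  moreover have "subring (carrier A \<times> {\<zero>\<^bsub>D\<^esub>}) S"
    by (rule S.A.subringI) (auto simp: ext_simps ext_minus)
  then have "ring S0"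
    unfolding trivial_component_eq by (rule S.A.subring_is_ring)
  ultimately show ?thesis
    using K.field_axioms
    by (intro field_algebra.intro field_algebra_axioms.intro)
      (auto simp: trivial_component_simps ext_simps smult_mult_left smult_mult_right)
qed

end

text \<open>The embedding of \<open>A\<close> in the first component is an algebra isomorphism onto
  \<open>S0\<close>, so a Frobenius isomorphism is transported by conjugating it with this embedding
  and its transpose.\<close>

lemma (in semitrivial) frobenius_if_trivial_component_frobenius:
  assumes "frobenius_algebra K S0"
  shows "frobenius_algebra K A"
proof -
  interpret S0: field_algebra K S0 by (rule trivial_component_field_algebra)
  obtain \<psi> where bij: "bij_betw \<psi> (carrier S0) (carrier S0.D)"
    and add: "\<And>x y. \<lbrakk>x \<in> carrier S0; y \<in> carrier S0\<rbrakk> \<Longrightarrow> \<psi> (x \<oplus>\<^bsub>S0\<^esub> y) = \<psi> x \<oplus>\<^bsub>S0.D\<^esub> \<psi> y"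
    and mult: "\<And>r x. \<lbrakk>r \<in> carrier S0; x \<in> carrier S0\<rbrakk> \<Longrightarrow> \<psi> (r \<otimes>\<^bsub>S0\<^esub> x) = r \<odot>\<^bsub>S0.D\<^esub> \<psi> x"
    using assms
    by (auto simp: frobenius_algebra_def left_module_isos_def regular_bimodule_def)
  define \<iota> where "\<iota> a = (a, \<zero>\<^bsub>D\<^esub>)" for a :: 'a
  have \<iota>: "\<iota> a \<in> carrier S0" "\<iota> (a \<oplus>\<^bsub>A\<^esub> b) = \<iota> a \<oplus>\<^bsub>S0\<^esub> \<iota> b" "\<iota> (a \<otimes>\<^bsub>A\<^esub> b) = \<iota> a \<otimes>\<^bsub>S0\<^esub> \<iota> b"
    "k \<in> carrier K \<Longrightarrow> \<iota> (k \<odot>\<^bsub>A\<^esub> a) = k \<odot>\<^bsub>S0\<^esub> \<iota> a"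
    if "a \<in> carrier A" "b \<in> carrier A" for a b k
    using that by (simp_all add: \<iota>_def trivial_component_simps ext_simps)
  have bij_\<iota>: "bij_betw \<iota> (carrier A) (carrier S0)"
    by (rule bij_betwI[of _ _ _ fst]) (auto simp: \<iota>_def trivial_component_simps)
  \<comment> \<open>\<open>\<rho>\<close> pulls functionals back along \<open>\<iota>\<close>, and
    its inverse \<open>\<rho>'\<close> pulls them back along the first projection; both restrict to
    the carriers because functionals are extensional.\<close>
  define \<rho> where "\<rho> L = (\<lambda>a\<in>carrier A. L (\<iota> a))" for L :: "'a \<times> ('a \<Rightarrow> 'k) \<Rightarrow> 'k"
  define \<rho>' where "\<rho>' f = (\<lambda>x\<in>carrier S0. f (fst x))" for f :: "'a \<Rightarrow> 'k"
  have \<rho>: "\<rho> L \<in> carrier D" if "L \<in> carrier S0.D" for L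
    by (rule dual_memI) (simp_all add: \<rho>_def \<iota> that)
  have \<rho>': "\<rho>' f \<in> carrier S0.D" if "f \<in> carrier D" for f
  proof (rule S0.dual_memI)
    show "\<rho>' f \<in> extensional (carrier S0)"
      by (simp add: \<rho>'_def)
  qed (use that in \<open>auto simp: \<rho>'_def trivial_component_simps ext_simps\<close>)
  have bij_\<rho>: "bij_betw \<rho> (carrier S0.D) (carrier D)"
  proof (rule bij_betwI[of _ _ _ \<rho>'])
    show "\<rho>' (\<rho> L) = L" if L: "L \<in> carrier S0.D" for L
      using \<rho>[OF L] L
      by (intro S0.dual_eqI \<rho>' L) (auto simp: \<rho>'_def \<rho>_def \<iota>_def trivial_component_simps)
    show "\<rho> (\<rho>' f) = f" if "f \<in> carrier D" for f
      using that by (intro dual_eqI \<rho> \<rho>') (auto simp: \<rho>'_def \<rho>_def \<iota>_def trivial_component_simps)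
  qed (use \<rho> \<rho>' in auto)
  have \<psi>_closed: "\<psi> (\<iota> x) \<in> carrier S0.D" if "x \<in> carrier A" for x
    using bij \<iota>(1) that by (auto simp: bij_betw_def)
  have "bij_betw (\<lambda>x. \<rho> (\<psi> (\<iota> x))) (carrier A) (carrier D)"
    using bij_betw_trans[OF bij_betw_trans[OF bij_\<iota> bij] bij_\<rho>] by (simp add: comp_def)
  moreover have "\<rho> (\<psi> (\<iota> (x \<oplus>\<^bsub>A\<^esub> y))) = \<rho> (\<psi> (\<iota> x)) \<oplus>\<^bsub>D\<^esub> \<rho> (\<psi> (\<iota> y))"
    if "x \<in> carrier A" "y \<in> carrier A" for x y
    using that
    by (intro dual_eqI dual_add_closed \<rho> \<psi>_closed) (simp_all add: \<rho>_def \<iota> add)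
  moreover have "\<rho> (\<psi> (\<iota> (r \<otimes>\<^bsub>A\<^esub> x))) = r \<odot>\<^bsub>D\<^esub> \<rho> (\<psi> (\<iota> x))"
    if "r \<in> carrier A" "x \<in> carrier A" for r x
    using that
    by (intro dual_eqI dual_left_closed \<rho> \<psi>_closed) (simp_all add: \<rho>_def \<iota> mult)
  ultimately have "(\<lambda>x. \<rho> (\<psi> (\<iota> x))) \<in> left_module_isos A (regular_bimodule A) D"
    by (simp add: left_module_isos_def regular_bimodule_def)
  then show ?thesis
    unfolding frobenius_algebra_def by blast
qed

section \<open>Testing associativity on the dual basis\<close>

locale based_pairing = semitrivial_pairing K A \<phi> + based_algebra K A I u d
  for K :: "('k, 'x) ring_scheme" (structure) and A :: "('k, 'a, 'y) module_scheme" (structure)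
    and \<phi> and I :: "'i set" and u d
begin

text \<open>Both sides of the associativity identity are linear in each of the three functionals, so
  it extends from the dual basis one argument at a time: first \<open>h\<close>, then
  \<open>g\<close>, then \<open>f\<close>.\<close>

lemma semitrivialI:
  assumes basis: "\<And>i j l. \<lbrakk>i \<in> I; j \<in> I; l \<in> I\<rbrakk>
      \<Longrightarrow> pairing (d i) (d j) \<odot>\<^bsub>D\<^esub> d l = rsmult D (d i) (pairing (d j) (d l))"
  shows "semitrivial K A \<phi>"
proof
  have smult: "(k \<odot>\<^bsub>A\<^esub> x) \<odot>\<^bsub>D\<^esub> f = dsmult k (x \<odot>\<^bsub>D\<^esub> f)" "x \<odot>\<^bsub>D\<^esub> dsmult k f = dsmult k (x \<odot>\<^bsub>D\<^esub> f)"
    "rsmult D f (k \<odot>\<^bsub>A\<^esub> x) = dsmult k (rsmult D f x)"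
    "rsmult D (dsmult k f) x = dsmult k (rsmult D f x)"
    if "k \<in> carrier K" "x \<in> carrier A" "f \<in> carrier D" for k x f
    using that by (auto intro!: dual_eqI simp: smult_mult_left smult_mult_right)
  note linear = smult pairing_add_left pairing_add_right pairing_dsmult_left pairing_dsmult_right
    D.left_add D.right_add D.left_add_scalar D.right_add_scalar coord_closed
  fix f g h assume f: "f \<in> carrier D" and g: "g \<in> carrier D" and h: "h \<in> carrier D"
  have basis2: "pairing (d i) (d j) \<odot>\<^bsub>D\<^esub> h = rsmult D (d i) (pairing (d j) h)" if "i \<in> I" "j \<in> I" for i j
    using h by (induction h rule: dual_induct) (simp_all add: linear basis that)
  have basis1: "pairing (d i) g \<odot>\<^bsub>D\<^esub> h = rsmult D (d i) (pairing g h)" if "i \<in> I" for i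
    using g by (induction g rule: dual_induct) (simp_all add: linear basis2 that h)
  show "pairing f g \<odot>\<^bsub>D\<^esub> h = rsmult D f (pairing g h)"
    using f by (induction f rule: dual_induct) (simp_all add: linear basis1 g h)
qed

end

section \<open>Finite dimension and symmetry of the extension\<close>

locale based_semitrivial = semitrivial K A \<phi> + based_algebra K A I u d
  for K :: "('k, 'x) ring_scheme" (structure) and A :: "('k, 'a, 'y) module_scheme" (structure)
    and \<phi> and I :: "'i set" and u d
begin

lemma trivial_component_fd: "fd_algebra K S0"
proof (rule fd_algebraI[OF trivial_component_field_algebra])
  show "finite ((\<lambda>i. (u i, \<zero>\<^bsub>D\<^esub>)) ` I)" "(\<lambda>i. (u i, \<zero>\<^bsub>D\<^esub>)) ` I \<subseteq> carrier S0"
    using finite_index basis_closed by (auto simp: trivial_component_simps)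
next
  fix x P
  assume x: "x \<in> carrier S0" and P0: "P \<zero>\<^bsub>S0\<^esub>"
    and base: "\<And>s. s \<in> (\<lambda>i. (u i, \<zero>\<^bsub>D\<^esub>)) ` I \<Longrightarrow> P s"
    and Padd: "\<And>x y. \<lbrakk>x \<in> carrier S0; y \<in> carrier S0; P x; P y\<rbrakk> \<Longrightarrow> P (x \<oplus>\<^bsub>S0\<^esub> y)"
    and Psmult: "\<And>k x. \<lbrakk>k \<in> carrier K; x \<in> carrier S0; P x\<rbrakk> \<Longrightarrow> P (k \<odot>\<^bsub>S0\<^esub> x)"
  obtain r where r: "r \<in> carrier A" and "x = (r, \<zero>\<^bsub>D\<^esub>)"
    using x by (auto simp: trivial_component_simps)
  moreover have "P (r, \<zero>\<^bsub>D\<^esub>)"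
    using r
  proof (induction r rule: basis_induct)
    case zero
    then show ?case using P0 by (simp add: trivial_component_simps ext_simps)
  next
    case (basis i)
    then show ?case using base by blast
  next
    case (add x y)
    then show ?case
      using Padd[of "(x, \<zero>\<^bsub>D\<^esub>)" "(y, \<zero>\<^bsub>D\<^esub>)"] by (simp add: trivial_component_simps ext_simps)
  next
    case (smult k x)
    then show ?case
      using Psmult[of k "(x, \<zero>\<^bsub>D\<^esub>)"] by (simp add: trivial_component_simps ext_simps)
  qed
  ultimately show "P x" by simp
qed

lemma ext_fd: "fd_algebra K S"
proof (rule fd_algebraI[OF ext_field_algebra])
  \<comment> \<open>The basis placed in trivial degree together with the dual basis placed in the
    other degree; the two components of an element are treated by separate inductions and then
    added.\<close>
  let ?B = "(\<lambda>i. (u i, \<zero>\<^bsub>D\<^esub>)) ` I \<union> (\<lambda>i. (\<zero>\<^bsub>A\<^esub>, d i)) ` I"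
  show "finite ?B" "?B \<subseteq> carrier S"
    using finite_index basis_closed coord_closed by (auto simp: ext_simps)
  fix x P
  assume x: "x \<in> carrier S" and P0: "P \<zero>\<^bsub>S\<^esub>" and base: "\<And>s. s \<in> ?B \<Longrightarrow> P s"
    and Padd: "\<And>x y. \<lbrakk>x \<in> carrier S; y \<in> carrier S; P x; P y\<rbrakk> \<Longrightarrow> P (x \<oplus>\<^bsub>S\<^esub> y)"
    and Psmult: "\<And>k x. \<lbrakk>k \<in> carrier K; x \<in> carrier S; P x\<rbrakk> \<Longrightarrow> P (k \<odot>\<^bsub>S\<^esub> x)"
  obtain r f where r: "r \<in> carrier A" and f: "f \<in> carrier D" and x: "x = (r, f)"
    using x by (auto simp: ext_simps)
  have "P (r, \<zero>\<^bsub>D\<^esub>)"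
    using r
  proof (induction r rule: basis_induct)
    case zero
    then show ?case using P0 by (simp add: ext_simps)
  next
    case (basis i)
    then show ?case using base by blast
  next
    case (add x y)
    then show ?case using Padd[of "(x, \<zero>\<^bsub>D\<^esub>)" "(y, \<zero>\<^bsub>D\<^esub>)"] by (simp add: ext_simps)
  next
    case (smult k x)
    then show ?case using Psmult[of k "(x, \<zero>\<^bsub>D\<^esub>)"] by (simp add: ext_simps)
  qed
  moreover have "P (\<zero>\<^bsub>A\<^esub>, f)"
    using f
  proof (induction f rule: dual_induct)
    case zero
    then show ?case using P0 by (simp add: ext_simps)
  next
    case (basis i)
    then show ?case using base by blast
  next
    case (add f g)
    then show ?case using Padd[of "(\<zero>\<^bsub>A\<^esub>, f)" "(\<zero>\<^bsub>A\<^esub>, g)"] by (simp add: ext_simps)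
  next
    case (smult k f)
    then show ?case using Psmult[of k "(\<zero>\<^bsub>A\<^esub>, f)"] by (simp add: ext_simps)
  qed
  ultimately show "P x"
    using Padd[of "(r, \<zero>\<^bsub>D\<^esub>)" "(\<zero>\<^bsub>A\<^esub>, f)"] r f x by (simp add: ext_simps)
qed

text \<open>The bilinear form of the functional "evaluate the second component at 1", curried so
  that it is itself the candidate isomorphism from the extension onto its dual.\<close>

definition trace_form :: "'a \<times> ('a \<Rightarrow> 'k) \<Rightarrow> 'a \<times> ('a \<Rightarrow> 'k) \<Rightarrow> 'k" where
  "trace_form x = (\<lambda>y\<in>carrier S. snd (x \<otimes>\<^bsub>S\<^esub> y) \<one>\<^bsub>A\<^esub>)"

lemma trace_form_apply:
  "\<lbrakk>r \<in> carrier A; f \<in> carrier D; s \<in> carrier A; g \<in> carrier D\<rbrakk>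
    \<Longrightarrow> trace_form (r, f) (s, g) = g r \<oplus>\<^bsub>K\<^esub> f s"
  by (simp add: trace_form_def ext_simps)

lemma trace_form_sym:
  "\<lbrakk>x \<in> carrier S; y \<in> carrier S\<rbrakk> \<Longrightarrow> trace_form x y = trace_form y x"
  by (auto simp: ext_simps trace_form_apply K.a_comm)

lemma trace_form_mult_right:
  "\<lbrakk>x \<in> carrier S; y \<in> carrier S; z \<in> carrier S\<rbrakk>
    \<Longrightarrow> trace_form (x \<otimes>\<^bsub>S\<^esub> y) z = trace_form x (y \<otimes>\<^bsub>S\<^esub> z)"
  by (simp add: trace_form_def S.A.m_assoc)

text \<open>Cyclic invariance: associativity moves \<open>x\<close> away from \<open>y\<close>,
  symmetry exchanges the two arguments, and associativity is used once more. It gives left linearity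
  of \<open>trace_form\<close>, as \<open>trace_form_mult_right\<close> gives right
  linearity.\<close>

lemma trace_form_mult_left:
  "\<lbrakk>x \<in> carrier S; y \<in> carrier S; z \<in> carrier S\<rbrakk>
    \<Longrightarrow> trace_form (x \<otimes>\<^bsub>S\<^esub> y) z = trace_form y (z \<otimes>\<^bsub>S\<^esub> x)"
  by (metis S.A.m_closed trace_form_mult_right trace_form_sym)

lemma trace_form_closed: "x \<in> carrier S \<Longrightarrow> trace_form x \<in> carrier S.D"
  by (rule S.dual_memI, unfold trace_form_def)
    (auto simp: ext_simps K.a_ac K.r_distr)

text \<open>Nondegeneracy by testing: the elements of trivial degree recover the functional
  component, and the dual basis in the other degree recovers the coordinates of the first
  component.\<close>

lemma trace_form_inj: "inj_on trace_form (carrier S)"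
proof (rule inj_onI)
  fix x y assume "x \<in> carrier S" "y \<in> carrier S" and eq: "trace_form x = trace_form y"
  then obtain r f s g where xy: "x = (r, f)" "y = (s, g)"
    and c: "r \<in> carrier A" "f \<in> carrier D" "s \<in> carrier A" "g \<in> carrier D"
    by (auto simp: ext_simps)
  have "f a = g a" if "a \<in> carrier A" for a
    using fun_cong[OF eq, of "(a, \<zero>\<^bsub>D\<^esub>)"] that c by (simp add: xy trace_form_apply)
  moreover have "d i r = d i s" if "i \<in> I" for i
    using fun_cong[OF eq, of "(\<zero>\<^bsub>A\<^esub>, d i)"] that c coord_closed by (simp add: xy trace_form_apply)
  ultimately show "x = y"
    using c by (simp add: xy dual_eqI eq_if_dual_eq)
qed

text \<open>A functional on the extension is determined by its restrictions to the two degrees. The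
  first is an element \<open>f\<close> of the dual; the second is a functional on the dual, which by
  finite dimension is evaluation at some \<open>r\<close>.\<close>

lemma trace_form_surj:
  assumes L: "L \<in> carrier S.D"
  shows "L \<in> trace_form ` carrier S"
proof -
  define f where "f = (\<lambda>s\<in>carrier A. L (s, \<zero>\<^bsub>D\<^esub>))"
  \<comment> \<open>The preimage under the canonical map to the bidual: its coordinates are the
    values of \<open>L\<close> on the dual basis.\<close>
  define r where "r = (\<Oplus>\<^bsub>A\<^esub>i\<in>I. L (\<zero>\<^bsub>A\<^esub>, d i) \<odot>\<^bsub>A\<^esub> u i)"
  have Lc: "L (s, g) \<in> carrier K" if "s \<in> carrier A" "g \<in> carrier D" for s g
    using that L by (intro S.dual_closed) (auto simp: ext_simps)
  have r: "r \<in> carrier A"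
    unfolding r_def using Lc basis_closed coord_closed by (intro M.finsum_closed) auto
  have f: "f \<in> carrier D"
  proof (rule dual_memI)
    show "f (x \<oplus>\<^bsub>A\<^esub> y) = f x \<oplus>\<^bsub>K\<^esub> f y" if "x \<in> carrier A" "y \<in> carrier A" for x y
      using S.dual_add[OF L, of "(x, \<zero>\<^bsub>D\<^esub>)" "(y, \<zero>\<^bsub>D\<^esub>)"] that by (simp add: f_def ext_simps)
    show "f (k \<odot>\<^bsub>A\<^esub> x) = k \<otimes>\<^bsub>K\<^esub> f x" if "k \<in> carrier K" "x \<in> carrier A" for k x
      using S.dual_smult[OF L, of k "(x, \<zero>\<^bsub>D\<^esub>)"] that by (simp add: f_def ext_simps)
  qed (auto simp: f_def Lc)
  have dr: "d j r = L (\<zero>\<^bsub>A\<^esub>, d j)" if j: "j \<in> I" for j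
  proof -
    have "d j r = (\<Oplus>\<^bsub>K\<^esub>i\<in>I. d j (L (\<zero>\<^bsub>A\<^esub>, d i) \<odot>\<^bsub>A\<^esub> u i))"
      unfolding r_def using Lc basis_closed coord_closed finite_index j
      by (intro dual_finsum) auto
    also have "\<dots> = (\<Oplus>\<^bsub>K\<^esub>i\<in>I. if j = i then L (\<zero>\<^bsub>A\<^esub>, d i) else \<zero>\<^bsub>K\<^esub>)"
      using Lc basis_closed coord_closed j
      by (intro K.finsum_cong') (auto simp: coord_basis)
    also have "\<dots> = L (\<zero>\<^bsub>A\<^esub>, d j)"
      using Lc coord_closed finite_index j by (intro K.finsum_singleton) auto
    finally show ?thesis .
  qed
  have eval: "g r = L (\<zero>\<^bsub>A\<^esub>, g)" if "g \<in> carrier D" for g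
    using that
  proof (induction g rule: dual_induct)
    case zero
    then show ?case
      using S.dual_zero[OF L] r by (simp add: ext_simps)
  next
    case (basis i)
    then show ?case by (rule dr)
  next
    case (add f g)
    then show ?case
      using S.dual_add[OF L, of "(\<zero>\<^bsub>A\<^esub>, f)" "(\<zero>\<^bsub>A\<^esub>, g)"] r by (simp add: ext_simps)
  next
    case (smult k f)
    then show ?case
      using S.dual_smult[OF L, of k "(\<zero>\<^bsub>A\<^esub>, f)"] r by (simp add: ext_simps)
  qed
  have "L = trace_form (r, f)"
  proof (rule S.dual_eqI[OF L])
    show "trace_form (r, f) \<in> carrier S.D"
      using r f by (intro trace_form_closed) (simp add: ext_simps)
    fix y assume "y \<in> carrier S"
    then obtain s g where y: "y = (s, g)" "s \<in> carrier A" "g \<in> carrier D"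
      by (auto simp: ext_simps)
    then show "L y = trace_form (r, f) y"
      using S.dual_add[OF L, of "(s, \<zero>\<^bsub>D\<^esub>)" "(\<zero>\<^bsub>A\<^esub>, g)"] r f Lc
      by (simp add: ext_simps trace_form_apply eval f_def K.a_comm)
  qed
  then show ?thesis
    using r f by (simp add: ext_simps)
qed

lemma ext_symmetric: "symmetric_algebra K S"
proof -
  have "bij_betw trace_form (carrier S) (carrier S.D)"
    using trace_form_inj trace_form_surj trace_form_closed by (auto simp: bij_betw_def)
  moreover have "trace_form (x \<oplus>\<^bsub>S\<^esub> y) = trace_form x \<oplus>\<^bsub>S.D\<^esub> trace_form y"
    if "x \<in> carrier S" "y \<in> carrier S" for x y
    using that
    by (intro S.dual_eqI trace_form_closed S.dual_add_closed)
      (auto simp: ext_simps trace_form_apply K.a_ac)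
  moreover have "trace_form (r \<otimes>\<^bsub>S\<^esub> x) = r \<odot>\<^bsub>S.D\<^esub> trace_form x"
    if "r \<in> carrier S" "x \<in> carrier S" for r x
    using that
    by (intro S.dual_eqI trace_form_closed S.dual_left_closed)
      (simp_all add: trace_form_mult_left)
  moreover have "trace_form (x \<otimes>\<^bsub>S\<^esub> r) = rsmult S.D (trace_form x) r"
    if "r \<in> carrier S" "x \<in> carrier S" for r x
    using that
    by (intro S.dual_eqI trace_form_closed S.dual_right_closed)
      (simp_all add: trace_form_mult_right)
  ultimately have "trace_form \<in> bimodule_isos S (regular_bimodule S) S.D"
    by (simp add: bimodule_isos_def left_module_isos_def regular_bimodule_def)
  then show ?thesis
    unfolding symmetric_algebra_def by blast
qed

end


section \<open>The nine-dimensional algebra\<close>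

lemma UNIV_idx: "UNIV = {I1, I2}"
  using idx.exhaust by auto

lemma UNIV_R9_basis: "UNIV = insert eE (range eX \<union> range eY \<union> range (\<lambda>(i, j). eF i j))"
proof -
  have "b \<in> insert eE (range eX \<union> range eY \<union> range (\<lambda>(i, j). eF i j))" for b
    by (cases b) auto
  then show ?thesis by blast
qed

lemma all_idx: "(\<forall>i. P i) \<longleftrightarrow> P I1 \<and> P I2"
  by (metis idx.exhaust)

lemma all_R9_basis:
  "(\<forall>b. P b) \<longleftrightarrow> P eE \<and> (\<forall>i. P (eX i)) \<and> (\<forall>i. P (eY i)) \<and> (\<forall>i j. P (eF i j))"
  by (metis R9_basis.exhaust)

instance idx :: finite
  by standard (simp add: UNIV_idx)

instance R9_basis :: finite
  by standard (simp add: UNIV_R9_basis)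

text \<open>All factorizations of each basis element, which are the index sets of the sums defining
  the coordinates of a product.\<close>

lemma R9_basis_mult_eq_Some:
  "{(p, q). R9_basis_mult p q = Some eE} = {(eE, eE)}"
  "{(p, q). R9_basis_mult p q = Some (eX i)} = {(eE, eX i), (eX I1, eF I1 i), (eX I2, eF I2 i)}"
  "{(p, q). R9_basis_mult p q = Some (eY i)} = {(eF i I1, eY I1), (eF i I2, eY I2), (eY i, eE)}"
  "{(p, q). R9_basis_mult p q = Some (eF i j)} = {(eF i I1, eF I1 j), (eF i I2, eF I2 j)}"
  unfolding set_eq_iff split_paired_All all_R9_basis all_idx
  by (cases i; cases j; simp)+

section \<open>Algebra laws in coordinates\<close>

locale R9_algebra = K?: field K for K :: "('k, 'x) ring_scheme" (structure)
begin

abbreviation "R \<equiv> R9 K"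

lemma R9_simps:
  "x \<in> carrier R \<longleftrightarrow> (\<forall>b. x b \<in> carrier K)"
  "(x \<oplus>\<^bsub>R\<^esub> y) b = x b \<oplus>\<^bsub>K\<^esub> y b"
  "\<zero>\<^bsub>R\<^esub> b = \<zero>\<^bsub>K\<^esub>"
  "\<one>\<^bsub>R\<^esub> b = (if b \<in> {eE, eF I1 I1, eF I2 I2} then \<one>\<^bsub>K\<^esub> else \<zero>\<^bsub>K\<^esub>)"
  "(k \<odot>\<^bsub>R\<^esub> x) b = k \<otimes>\<^bsub>K\<^esub> x b"
  by (auto simp: R9_def)

lemma R9_apply_closed [simp]: "x \<in> carrier R \<Longrightarrow> x b \<in> carrier K"
  by (simp add: R9_simps)

lemma R9_mult_eq: "(x \<otimes>\<^bsub>R\<^esub> y) b =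
    (\<Oplus>\<^bsub>K\<^esub>t\<in>{(p, q). R9_basis_mult p q = Some b}. x (fst t) \<otimes>\<^bsub>K\<^esub> y (snd t))"
  by (simp add: R9_def)

text \<open>This is multiplication of block matrices with a scalar block E, a row vector X, a column
  vector Y and a 2 by 2 matrix F, where the products of X with Y and of Y with X are replaced by
  zero.\<close>

lemma R9_mult:
  assumes "x \<in> carrier R" "y \<in> carrier R"
  shows "(x \<otimes>\<^bsub>R\<^esub> y) eE = x eE \<otimes>\<^bsub>K\<^esub> y eE"
    "(x \<otimes>\<^bsub>R\<^esub> y) (eX i) = x eE \<otimes>\<^bsub>K\<^esub> y (eX i) \<oplus>\<^bsub>K\<^esub>
      (x (eX I1) \<otimes>\<^bsub>K\<^esub> y (eF I1 i) \<oplus>\<^bsub>K\<^esub> x (eX I2) \<otimes>\<^bsub>K\<^esub> y (eF I2 i))"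
    "(x \<otimes>\<^bsub>R\<^esub> y) (eY i) = x (eF i I1) \<otimes>\<^bsub>K\<^esub> y (eY I1) \<oplus>\<^bsub>K\<^esub>
      (x (eF i I2) \<otimes>\<^bsub>K\<^esub> y (eY I2) \<oplus>\<^bsub>K\<^esub> x (eY i) \<otimes>\<^bsub>K\<^esub> y eE)"
    "(x \<otimes>\<^bsub>R\<^esub> y) (eF i j) =
      x (eF i I1) \<otimes>\<^bsub>K\<^esub> y (eF I1 j) \<oplus>\<^bsub>K\<^esub> x (eF i I2) \<otimes>\<^bsub>K\<^esub> y (eF I2 j)"
  using assms unfolding R9_mult_eq R9_basis_mult_eq_Some by (simp_all add: R9_simps)

lemma R9_mult_closed: "\<lbrakk>x \<in> carrier R; y \<in> carrier R\<rbrakk> \<Longrightarrow> x \<otimes>\<^bsub>R\<^esub> y \<in> carrier R"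
  unfolding R9_simps(1) R9_mult_eq by (auto intro!: K.finsum_closed)

lemma R9_abelian_group: "abelian_group R"
proof (rule abelian_groupI)
  fix x assume "x \<in> carrier R"
  then show "\<exists>y\<in>carrier R. y \<oplus>\<^bsub>R\<^esub> x = \<zero>\<^bsub>R\<^esub>"
    by (intro bexI[of _ "\<lambda>b. \<ominus>\<^bsub>K\<^esub> x b"]) (auto simp: R9_simps K.l_neg)
qed (auto simp: R9_simps K.a_ac)

lemma R9_field_algebra: "field_algebra K R"
proof -
  have ring: "ring R"
  proof (rule ringI[OF R9_abelian_group])
    show "Group.monoid R"
    proof (rule monoidI)
      fix x y z assume xyz: "x \<in> carrier R" "y \<in> carrier R" "z \<in> carrier R"
      show "(x \<otimes>\<^bsub>R\<^esub> y) \<otimes>\<^bsub>R\<^esub> z = x \<otimes>\<^bsub>R\<^esub> (y \<otimes>\<^bsub>R\<^esub> z)"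
      proof (rule ext)
        fix b show "((x \<otimes>\<^bsub>R\<^esub> y) \<otimes>\<^bsub>R\<^esub> z) b = (x \<otimes>\<^bsub>R\<^esub> (y \<otimes>\<^bsub>R\<^esub> z)) b"
          \<comment> \<open>Expansion by \<open>R9_mult\<close> leaves one identity over
            \<open>K\<close> per coordinate, settled by distributivity and associativity.\<close>
          using xyz
          by (cases b) (simp_all add: R9_mult R9_mult_closed, simp_all add: R9_simps
              K.l_distr K.r_distr K.m_assoc K.a_ac)
      qed
    next
      fix x assume x: "x \<in> carrier R"
      have one: "\<one>\<^bsub>R\<^esub> \<in> carrier R" by (simp add: R9_simps)
      show "\<one>\<^bsub>R\<^esub> \<otimes>\<^bsub>R\<^esub> x = x" "x \<otimes>\<^bsub>R\<^esub> \<one>\<^bsub>R\<^esub> = x"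
        using x unfolding fun_eq_iff all_R9_basis all_idx
        by (simp_all add: R9_mult one, simp_all add: R9_simps)
    qed (use R9_mult_closed in \<open>auto simp: R9_simps(1,4)\<close>)
  next
    fix x y z assume xyz: "x \<in> carrier R" "y \<in> carrier R" "z \<in> carrier R"
    have add: "v \<oplus>\<^bsub>R\<^esub> w \<in> carrier R" if "v \<in> carrier R" "w \<in> carrier R" for v w
      using that by (simp add: R9_simps)
    show "(x \<oplus>\<^bsub>R\<^esub> y) \<otimes>\<^bsub>R\<^esub> z = x \<otimes>\<^bsub>R\<^esub> z \<oplus>\<^bsub>R\<^esub> y \<otimes>\<^bsub>R\<^esub> z"
      "z \<otimes>\<^bsub>R\<^esub> (x \<oplus>\<^bsub>R\<^esub> y) = z \<otimes>\<^bsub>R\<^esub> x \<oplus>\<^bsub>R\<^esub> z \<otimes>\<^bsub>R\<^esub> y"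
      using xyz unfolding fun_eq_iff all_R9_basis
      by (simp_all add: R9_mult R9_mult_closed R9_simps(2) add,
          simp_all add: R9_simps K.l_distr K.r_distr K.a_ac)
  qed
  have module: "Module.module K R"
    by (rule moduleI[OF K.is_cring R9_abelian_group])
      (auto simp: R9_simps fun_eq_iff K.l_distr K.r_distr K.m_assoc)
  have "(k \<odot>\<^bsub>R\<^esub> x) \<otimes>\<^bsub>R\<^esub> y = k \<odot>\<^bsub>R\<^esub> (x \<otimes>\<^bsub>R\<^esub> y)" "x \<otimes>\<^bsub>R\<^esub> (k \<odot>\<^bsub>R\<^esub> y) = k \<odot>\<^bsub>R\<^esub> (x \<otimes>\<^bsub>R\<^esub> y)"
    if "k \<in> carrier K" "x \<in> carrier R" "y \<in> carrier R" for k x y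
  proof -
    have smult: "k \<odot>\<^bsub>R\<^esub> v \<in> carrier R" if "v \<in> carrier R" for v
      using that \<open>k \<in> carrier K\<close> by (simp add: R9_simps)
    show "(k \<odot>\<^bsub>R\<^esub> x) \<otimes>\<^bsub>R\<^esub> y = k \<odot>\<^bsub>R\<^esub> (x \<otimes>\<^bsub>R\<^esub> y)" "x \<otimes>\<^bsub>R\<^esub> (k \<odot>\<^bsub>R\<^esub> y) = k \<odot>\<^bsub>R\<^esub> (x \<otimes>\<^bsub>R\<^esub> y)"
      using that unfolding fun_eq_iff all_R9_basis
      by (simp_all add: R9_mult smult R9_simps(5), simp_all add: R9_simps K.r_distr K.m_ac)
  qed
  then show ?thesis
    using ring module K.field_axioms
    by (intro field_algebra.intro field_algebra_axioms.intro) auto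
qed

sublocale field_algebra K R
  by (rule R9_field_algebra)

section \<open>Basis vectors, the dual basis and the actions between them\<close>

definition unit :: "R9_basis \<Rightarrow> R9_basis \<Rightarrow> 'k" where
  "unit p = (\<lambda>b. if b = p then \<one>\<^bsub>K\<^esub> else \<zero>\<^bsub>K\<^esub>)"

definition coord :: "R9_basis \<Rightarrow> (R9_basis \<Rightarrow> 'k) \<Rightarrow> 'k" where
  "coord b = (\<lambda>x\<in>carrier R. x b)"

lemma unit_closed [simp]: "unit p \<in> carrier R"
  by (simp add: R9_simps unit_def)

lemma unit_apply: "unit p b = (if b = p then \<one>\<^bsub>K\<^esub> else \<zero>\<^bsub>K\<^esub>)"
  by (simp add: unit_def)

lemma coord_apply [simp]: "x \<in> carrier R \<Longrightarrow> coord b x = x b"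
  by (simp add: coord_def)

lemma coord_mem [simp]: "coord b \<in> carrier D"
  by (rule dual_memI) (auto simp: coord_def R9_simps)

lemma R9_finsum_apply:
  assumes "finite J" "v \<in> J \<rightarrow> carrier R"
  shows "(\<Oplus>\<^bsub>R\<^esub>i\<in>J. v i) b = (\<Oplus>\<^bsub>K\<^esub>i\<in>J. v i b)"
  using assms
  by (induction J) (simp_all add: Pi_iff R9_simps)

sublocale based_algebra K R UNIV unit coord
proof
  fix x assume x: "x \<in> carrier R"
  show "x = (\<Oplus>\<^bsub>R\<^esub>p\<in>UNIV. coord p x \<odot>\<^bsub>R\<^esub> unit p)"
  proof
    fix b
    have "(\<Oplus>\<^bsub>R\<^esub>p\<in>UNIV. coord p x \<odot>\<^bsub>R\<^esub> unit p) b = (\<Oplus>\<^bsub>K\<^esub>p\<in>UNIV. (coord p x \<odot>\<^bsub>R\<^esub> unit p) b)"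
      using x by (intro R9_finsum_apply) auto
    also have "\<dots> = (\<Oplus>\<^bsub>K\<^esub>p\<in>UNIV. if b = p then x p else \<zero>\<^bsub>K\<^esub>)"
      using x by (intro K.finsum_cong') (auto simp: R9_simps unit_apply)
    also have "\<dots> = x b"
      using x by (intro K.finsum_singleton) (auto simp: R9_simps)
    finally show "x b = (\<Oplus>\<^bsub>R\<^esub>p\<in>UNIV. coord p x \<odot>\<^bsub>R\<^esub> unit p) b" ..
  qed
qed (auto simp: unit_apply)

definition unit_opt :: "R9_basis option \<Rightarrow> R9_basis \<Rightarrow> 'k" where
  "unit_opt z = (case z of None \<Rightarrow> \<zero>\<^bsub>R\<^esub> | Some b \<Rightarrow> unit b)"

lemma unit_opt_simps [simp]: "unit_opt None = \<zero>\<^bsub>R\<^esub>" "unit_opt (Some b) = unit b"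
  by (simp_all add: unit_opt_def)

lemma unit_opt_closed [simp]: "unit_opt z \<in> carrier R"
  by (cases z) simp_all

lemma unit_opt_apply: "unit_opt z b = (if z = Some b then \<one>\<^bsub>K\<^esub> else \<zero>\<^bsub>K\<^esub>)"
  by (cases z) (auto simp: unit_apply R9_simps)

text \<open>In the sum for coordinate \<open>b\<close> only the index \<open>(p, q)\<close> can
  contribute, and it belongs to the index set exactly when the table sends \<open>(p, q)\<close> to
  \<open>b\<close>.\<close>

lemma unit_mult: "unit p \<otimes>\<^bsub>R\<^esub> unit q = unit_opt (R9_basis_mult p q)"
proof
  fix b
  let ?J = "{(p, q). R9_basis_mult p q = Some b}"
  have "(unit p \<otimes>\<^bsub>R\<^esub> unit q) b = (\<Oplus>\<^bsub>K\<^esub>t\<in>?J. if (p, q) = t then \<one>\<^bsub>K\<^esub> else \<zero>\<^bsub>K\<^esub>)"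
    unfolding R9_mult_eq by (intro K.finsum_cong') (auto simp: unit_apply)
  also have "\<dots> = unit_opt (R9_basis_mult p q) b"
  proof (cases "(p, q) \<in> ?J")
    case True
    then have "(\<Oplus>\<^bsub>K\<^esub>t\<in>?J. if (p, q) = t then \<one>\<^bsub>K\<^esub> else \<zero>\<^bsub>K\<^esub>) = \<one>\<^bsub>K\<^esub>"
      by (intro K.finsum_singleton) auto
    then show ?thesis
      using True by (simp add: unit_opt_apply unit_apply)
  next
    case False
    then have "(\<Oplus>\<^bsub>K\<^esub>t\<in>?J. if (p, q) = t then \<one>\<^bsub>K\<^esub> else \<zero>\<^bsub>K\<^esub>) = (\<Oplus>\<^bsub>K\<^esub>t\<in>?J. \<zero>\<^bsub>K\<^esub>)"
      by (intro K.finsum_cong') auto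
    then show ?thesis
      using False by (simp add: unit_opt_apply)
  qed
  finally show "(unit p \<otimes>\<^bsub>R\<^esub> unit q) b = unit_opt (R9_basis_mult p q) b" .
qed

text \<open>Translating a basis coordinate by a basis element gives a single coordinate or zero, since
  \<open>a p = b\<close> (resp. \<open>p a = b\<close>) has at most one solution \<open>a\<close> among the basis elements.\<close>

lemma left_unit_coord:
  assumes "\<And>a. R9_basis_mult a p = Some b \<longleftrightarrow> z = Some a"
  shows "unit p \<odot>\<^bsub>D\<^esub> coord b = (case z of None \<Rightarrow> \<zero>\<^bsub>D\<^esub> | Some q \<Rightarrow> coord q)"
  by (rule dual_eq_if_basis_eq) (auto simp: unit_mult unit_opt_apply assms unit_apply split: option.split)

lemma right_unit_coord:
  assumes "\<And>a. R9_basis_mult p a = Some b \<longleftrightarrow> z = Some a"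
  shows "rsmult D (coord b) (unit p) = (case z of None \<Rightarrow> \<zero>\<^bsub>D\<^esub> | Some q \<Rightarrow> coord q)"
  by (rule dual_eq_if_basis_eq) (auto simp: unit_mult unit_opt_apply assms unit_apply split: option.split)

text \<open>Each \<open>z\<close> is the solution \<open>a\<close> of \<open>a p = b\<close> read
  off the multiplication table. The rows for \<open>eE\<close> record which dual basis elements are
  fixed or killed by E, as needed for \<open>pairing_weight\<close>.\<close>

lemma left_actions:
  "unit (eF k l) \<odot>\<^bsub>D\<^esub> coord (eX l) = coord (eX k)"
  "unit (eX i) \<odot>\<^bsub>D\<^esub> coord (eX l) = (if i = l then coord eE else \<zero>\<^bsub>D\<^esub>)"
  "unit (eY j) \<odot>\<^bsub>D\<^esub> coord (eY i) = coord (eF i j)"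
  "unit eE \<odot>\<^bsub>D\<^esub> coord eE = coord eE"
  "unit eE \<odot>\<^bsub>D\<^esub> coord (eY i) = coord (eY i)"
  "unit eE \<odot>\<^bsub>D\<^esub> coord (eX i) = \<zero>\<^bsub>D\<^esub>"
  "unit eE \<odot>\<^bsub>D\<^esub> coord (eF i j) = \<zero>\<^bsub>D\<^esub>"
  subgoal by (subst left_unit_coord[where z = "Some (eX k)"], case_tac a) auto
  subgoal by (subst left_unit_coord[where z = "if i = l then Some eE else None"], case_tac a) auto
  subgoal by (subst left_unit_coord[where z = "Some (eF i j)"], case_tac a) auto
  subgoal by (subst left_unit_coord[where z = "Some eE"], case_tac a) auto
  subgoal by (subst left_unit_coord[where z = "Some (eY i)"], case_tac a) auto
  subgoal by (subst left_unit_coord[where z = None], case_tac a) auto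
  subgoal by (subst left_unit_coord[where z = None], case_tac a) auto
  done

lemma right_actions:
  "rsmult D (coord (eY k)) (unit (eF k l)) = coord (eY l)"
  "rsmult D (coord (eY i)) (unit (eY j)) = (if i = j then coord eE else \<zero>\<^bsub>D\<^esub>)"
  "rsmult D (coord (eX i)) (unit (eX j)) = coord (eF j i)"
  "rsmult D (coord eE) (unit eE) = coord eE"
  "rsmult D (coord (eX i)) (unit eE) = coord (eX i)"
  "rsmult D (coord (eY i)) (unit eE) = \<zero>\<^bsub>D\<^esub>"
  "rsmult D (coord (eF i j)) (unit eE) = \<zero>\<^bsub>D\<^esub>"
  subgoal by (subst right_unit_coord[where z = "Some (eY l)"], case_tac a) auto
  subgoal by (subst right_unit_coord[where z = "if i = j then Some eE else None"], case_tac a) auto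
  subgoal by (subst right_unit_coord[where z = "Some (eF j i)"], case_tac a) auto
  subgoal by (subst right_unit_coord[where z = "Some eE"], case_tac a) auto
  subgoal by (subst right_unit_coord[where z = "Some (eX i)"], case_tac a) auto
  subgoal by (subst right_unit_coord[where z = None], case_tac a) auto
  subgoal by (subst right_unit_coord[where z = None], case_tac a) auto
  done

end

text \<open>The values of the pairing on the dual basis, up to a common scalar; \<open>None\<close> is zero.\<close>

fun R9_dual_mult :: "R9_basis \<Rightarrow> R9_basis \<Rightarrow> R9_basis option" where
  "R9_dual_mult (eY i) (eX j) = (if i = j then Some eE else None)"
| "R9_dual_mult (eX i) (eY j) = Some (eF i j)"
| "R9_dual_mult eE (eY i) = Some (eX i)"
| "R9_dual_mult (eY k) (eF i j) = (if j = k then Some (eX i) else None)"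
| "R9_dual_mult (eX i) eE = Some (eY i)"
| "R9_dual_mult (eF i j) (eX k) = (if i = k then Some (eY j) else None)"
| "R9_dual_mult _ _ = None"

text \<open>The associativity identity on three dual basis elements, evaluated at the basis element
  \<open>p\<close>: each side says when the corresponding value is nonzero. The verification is a
  finite case analysis.\<close>

lemma R9_dual_mult_assoc:
  "(\<exists>q. R9_dual_mult b b' = Some q \<and> R9_basis_mult p q = Some b'') \<longleftrightarrow>
   (\<exists>q. R9_dual_mult b' b'' = Some q \<and> R9_basis_mult q p = Some b)"
  by (cases b; cases b'; cases b''; cases p) auto

section \<open>Values of the pairing on the dual basis\<close>

locale R9_pairing = R9_algebra K + semitrivial_pairing K "R9 K" \<phi>
  for K :: "('k, 'x) ring_scheme" (structure) and \<phi>
begin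

sublocale based_pairing K R \<phi> UNIV unit coord
  by unfold_locales

definition \<mu> :: 'k where
  "\<mu> = pairing (coord (eX I1)) (coord (eY I1)) (eF I1 I1)"

lemma scale_closed [simp]: "\<mu> \<in> carrier K"
  using pairing_closed[OF coord_mem coord_mem, of "eX I1" "eY I1"] by (simp add: \<mu>_def R9_simps)

lemma coord_pairing_left:
  "pairing (unit p \<odot>\<^bsub>D\<^esub> coord b) (coord b') = unit p \<otimes>\<^bsub>R\<^esub> pairing (coord b) (coord b')"
  by (simp add: pairing_left)

lemma coord_pairing_right:
  "pairing (coord b) (rsmult D (coord b') (unit p)) = pairing (coord b) (coord b') \<otimes>\<^bsub>R\<^esub> unit p"
  by (simp add: pairing_right)

lemma coord_pairing_balanced:
  "pairing (rsmult D (coord b) (unit p)) (coord b') = pairing (coord b) (unit p \<odot>\<^bsub>D\<^esub> coord b')"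
  by (simp add: pairing_balanced)

text \<open>The corner cut out by the idempotent F_11 is one-dimensional; this confines the value
  defining \<open>\<mu>\<close> to a line.\<close>

lemma F_mult_F:
  assumes "x \<in> carrier R"
  shows "unit (eF I1 I1) \<otimes>\<^bsub>R\<^esub> x \<otimes>\<^bsub>R\<^esub> unit (eF I1 I1) = x (eF I1 I1) \<odot>\<^bsub>R\<^esub> unit (eF I1 I1)"
  using assms unfolding fun_eq_iff all_R9_basis all_idx
  by (simp add: R9_mult R9_mult_closed) (simp add: R9_simps unit_apply)

text \<open>The corner of the idempotent E is one-dimensional as well, which confines the values in
  \<open>pairing_Y_X\<close>.\<close>

lemma E_mult_E:
  assumes "x \<in> carrier R"
  shows "unit eE \<otimes>\<^bsub>R\<^esub> x \<otimes>\<^bsub>R\<^esub> unit eE = x eE \<odot>\<^bsub>R\<^esub> unit eE"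
  using assms unfolding fun_eq_iff all_R9_basis all_idx
  by (simp add: R9_mult R9_mult_closed) (simp add: R9_simps unit_apply)

text \<open>\<open>coord (eX i)\<close> is the left translate of \<open>coord (eX I1)\<close> by
  F_i1 and \<open>coord (eY j)\<close> the right translate of \<open>coord (eY I1)\<close> by F_1j,
  so both factors can be pulled out. For i = j = 1 this sandwiches the value between two copies of
  F_11.\<close>

lemma pairing_X_Y: "pairing (coord (eX i)) (coord (eY j)) = \<mu> \<odot>\<^bsub>R\<^esub> unit (eF i j)"
proof -
  have *: "pairing (coord (eX i)) (coord (eY j)) =
      unit (eF i I1) \<otimes>\<^bsub>R\<^esub> pairing (coord (eX I1)) (coord (eY I1)) \<otimes>\<^bsub>R\<^esub> unit (eF I1 j)" for i j
    using coord_pairing_left[where b = "eX I1" and p = "eF i I1" and b' = "eY j"]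
      coord_pairing_right[where b = "eX I1" and p = "eF I1 j" and b' = "eY I1"]
    by (simp add: left_actions right_actions A.m_assoc)
  have "pairing (coord (eX I1)) (coord (eY I1)) = \<mu> \<odot>\<^bsub>R\<^esub> unit (eF I1 I1)"
    using *[of I1 I1] F_mult_F[of "pairing (coord (eX I1)) (coord (eY I1))"] by (simp add: \<mu>_def)
  then show ?thesis
    by (subst *) (simp add: smult_mult_left smult_mult_right unit_mult)
qed

text \<open>\<open>coord eE\<close> is the left translate of \<open>coord (eX I1)\<close> by X_1,
  and X_1 F_1i = X_i.\<close>

lemma pairing_E_Y: "pairing (coord eE) (coord (eY i)) = \<mu> \<odot>\<^bsub>R\<^esub> unit (eX i)"
  using coord_pairing_left[where b = "eX I1" and p = "eX I1" and b' = "eY i"]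
  by (simp add: left_actions pairing_X_Y smult_mult_right unit_mult)

lemma pairing_X_E: "pairing (coord (eX i)) (coord eE) = \<mu> \<odot>\<^bsub>R\<^esub> unit (eY i)"
  using coord_pairing_right[where b = "eX i" and p = "eY I1" and b' = "eY I1"]
  by (simp add: right_actions pairing_X_Y smult_mult_left unit_mult)

text \<open>Pulling X_1 out of the left argument leaves a multiple of X_1 Y_1, which is
  zero.\<close>

lemma pairing_E_E: "pairing (coord eE) (coord eE) = \<zero>\<^bsub>R\<^esub>"
  using coord_pairing_left[where b = "eX I1" and p = "eX I1" and b' = eE]
  by (simp add: left_actions pairing_X_E smult_mult_right unit_mult)

text \<open>\<open>coord (eF i j)\<close> is the right translate of \<open>coord (eX j)\<close> by
  X_i. Balance moves X_i to the other argument, where it yields \<open>coord eE\<close> or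
  zero.\<close>

lemma pairing_F_X:
  "pairing (coord (eF i j)) (coord (eX k)) = (if i = k then \<mu> \<odot>\<^bsub>R\<^esub> unit (eY j) else \<zero>\<^bsub>R\<^esub>)"
  using coord_pairing_balanced[where b = "eX j" and p = "eX i" and b' = "eX k"]
  by (simp add: left_actions right_actions pairing_X_E split: if_splits)

text \<open>Pulling X_k out of the right argument leaves Y_j X_k or zero by
  \<open>pairing_F_X\<close>, and Y_j X_k vanishes.\<close>

lemma pairing_F_F: "pairing (coord (eF i j)) (coord (eF k l)) = \<zero>\<^bsub>R\<^esub>"
  using coord_pairing_right[where b = "eF i j" and p = "eX k" and b' = "eX l"]
  by (simp add: right_actions pairing_F_X smult_mult_left unit_mult split: if_splits)

text \<open>Here \<open>coord (eF i j)\<close> is written as the left translate of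
  \<open>coord (eY i)\<close> by Y_j, and balance moves Y_j to the left argument.\<close>

lemma pairing_Y_F:
  "pairing (coord (eY k)) (coord (eF i j)) = (if j = k then \<mu> \<odot>\<^bsub>R\<^esub> unit (eX i) else \<zero>\<^bsub>R\<^esub>)"
  using coord_pairing_balanced[where b = "eY k" and p = "eY j" and b' = "eY i"]
  by (auto simp: left_actions right_actions pairing_E_Y)

text \<open>Right multiplication by \<open>X\<^sub>1\<close> reduces this value to \<open>pairing_Y_F\<close>; that is why its scalar
  agrees with the one of \<open>pairing_X_Y\<close>.\<close>

lemma pairing_Y_X:
  "pairing (coord (eY i)) (coord (eX j)) = (if i = j then \<mu> \<odot>\<^bsub>R\<^esub> unit eE else \<zero>\<^bsub>R\<^esub>)"
proof -
  let ?x = "pairing (coord (eY i)) (coord (eX j))"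
  \<comment> \<open>E fixes \<open>coord (eY i)\<close> from the left and
    \<open>coord (eX j)\<close> from the right, so the value lies in the corner of E.\<close>
  have x: "?x = ?x eE \<odot>\<^bsub>R\<^esub> unit eE"
    using coord_pairing_left[where b = "eY i" and p = eE and b' = "eX j"] coord_pairing_right[where b = "eY i" and p = eE and b' = "eX j"]
      E_mult_E[of ?x]
    by (simp add: left_actions right_actions A.m_assoc)
  have "?x \<otimes>\<^bsub>R\<^esub> unit (eX I1) = pairing (coord (eY i)) (coord (eF I1 j))"
    using coord_pairing_right[where b = "eY i" and p = "eX I1" and b' = "eX j"] by (simp add: right_actions)
  moreover have "(?x \<otimes>\<^bsub>R\<^esub> unit (eX I1)) (eX I1) = ?x eE"
    using pairing_closed[OF coord_mem coord_mem, of "eY i" "eX j"]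
    by (simp add: R9_mult unit_apply)
  ultimately have "?x eE = (if i = j then \<mu> else \<zero>\<^bsub>K\<^esub>)"
    by (auto simp: pairing_Y_F R9_simps unit_apply)
  then show ?thesis
    by (subst x) simp
qed

text \<open>By balance E may be shifted between the arguments; if it fixes one on the inner side and
  kills the other, the value is zero.\<close>

lemma pairing_weight:
  "unit eE \<odot>\<^bsub>D\<^esub> coord b' = \<zero>\<^bsub>D\<^esub> \<Longrightarrow> rsmult D (coord b) (unit eE) = coord b
    \<Longrightarrow> pairing (coord b) (coord b') = \<zero>\<^bsub>R\<^esub>"
  "unit eE \<odot>\<^bsub>D\<^esub> coord b' = coord b' \<Longrightarrow> rsmult D (coord b) (unit eE) = \<zero>\<^bsub>D\<^esub>
    \<Longrightarrow> pairing (coord b) (coord b') = \<zero>\<^bsub>R\<^esub>"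
  using coord_pairing_balanced[where b = b and p = eE and b' = b'] by simp_all

text \<open>Of the sixteen combinations of types, eight are computed above; in the other eight E
  fixes one argument and kills the other, so \<open>pairing_weight\<close> applies.\<close>

lemma pairing_coord: "pairing (coord b) (coord b') = \<mu> \<odot>\<^bsub>R\<^esub> unit_opt (R9_dual_mult b b')"
  by (cases b; cases b')
    (simp_all add: pairing_X_Y pairing_E_Y pairing_X_E pairing_E_E pairing_F_X pairing_F_F
      pairing_Y_F pairing_Y_X pairing_weight left_actions right_actions)

sublocale based_semitrivial K R \<phi> UNIV unit coord
proof -
  have "pairing (coord b) (coord b') \<odot>\<^bsub>D\<^esub> coord b'' =
      rsmult D (coord b) (pairing (coord b') (coord b''))"
    for b b' b''
  proof (rule dual_eq_if_basis_eq)
    fix p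
    have "(unit p \<otimes>\<^bsub>R\<^esub> unit_opt z) a =
          (if \<exists>q. z = Some q \<and> R9_basis_mult p q = Some a then \<one>\<^bsub>K\<^esub> else \<zero>\<^bsub>K\<^esub>) \<and>
        (unit_opt z \<otimes>\<^bsub>R\<^esub> unit p) a =
          (if \<exists>q. z = Some q \<and> R9_basis_mult q p = Some a then \<one>\<^bsub>K\<^esub> else \<zero>\<^bsub>K\<^esub>)" for z a
    proof (cases z)
      case None
      then show ?thesis by (simp add: R9_simps(3))
    next
      case (Some q)
      then show ?thesis by (simp add: unit_mult unit_opt_apply)
    qed
    note unit_products = this
    \<comment> \<open>At a basis vector both sides become \<open>\<mu>\<close> times an indicator,
      and \<open>R9_dual_mult_assoc\<close> says that the two indicators coincide.\<close>
    show "(pairing (coord b) (coord b') \<odot>\<^bsub>D\<^esub> coord b'') (unit p) =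
        rsmult D (coord b) (pairing (coord b') (coord b'')) (unit p)"
      by (simp add: pairing_coord smult_mult_left smult_mult_right R9_simps(5) unit_products
          R9_dual_mult_assoc)
  qed simp_all
  then interpret semitrivial K R \<phi>
    by (rule semitrivialI)
  show "based_semitrivial K R \<phi> UNIV unit coord"
    by unfold_locales
qed

end

section \<open>Failure of the Frobenius property\<close>

context R9_algebra
begin

lemma not_frobenius: "\<not> frobenius_algebra K R"
proof
  assume "frobenius_algebra K R"
  then obtain \<psi> where bij: "bij_betw \<psi> (carrier R) (carrier D)"
    and add: "\<And>x y. \<lbrakk>x \<in> carrier R; y \<in> carrier R\<rbrakk> \<Longrightarrow> \<psi> (x \<oplus>\<^bsub>R\<^esub> y) = \<psi> x \<oplus>\<^bsub>D\<^esub> \<psi> y"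
    and mult: "\<And>r x. \<lbrakk>r \<in> carrier R; x \<in> carrier R\<rbrakk> \<Longrightarrow> \<psi> (r \<otimes>\<^bsub>R\<^esub> x) = r \<odot>\<^bsub>D\<^esub> \<psi> x"
    by (auto simp: frobenius_algebra_def left_module_isos_def regular_bimodule_def)
  have closed [simp]: "\<psi> x \<in> carrier D" if "x \<in> carrier R" for x
    using bij that by (auto simp: bij_betw_def)
  have inj: "x = y" if "\<psi> x = \<psi> y" "x \<in> carrier R" "y \<in> carrier R" for x y
    using bij that by (auto simp: bij_betw_def inj_on_def)
  \<comment> \<open>An isomorphism of left modules is required only to be additive and compatible
    with the algebra; homogeneity comes from the multiples of the unit.\<close>
  have smult: "\<psi> (k \<odot>\<^bsub>R\<^esub> x) = dsmult k (\<psi> x)" if "k \<in> carrier K" "x \<in> carrier R" for k x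
    using mult[of "k \<odot>\<^bsub>R\<^esub> \<one>\<^bsub>R\<^esub>" x] that by (simp add: smult_mult_left dsmult_eq_left)
  have zero: "\<psi> \<zero>\<^bsub>R\<^esub> = \<zero>\<^bsub>D\<^esub>"
  proof -
    have "dsmult \<zero>\<^bsub>K\<^esub> (\<psi> \<zero>\<^bsub>R\<^esub>) = \<zero>\<^bsub>D\<^esub>"
      by (rule dual_eqI) simp_all
    then show ?thesis
      using smult[of "\<zero>\<^bsub>K\<^esub>" "\<zero>\<^bsub>R\<^esub>"] by simp
  qed
  \<comment> \<open>This and the next fact are E X_i = X_i and Y_j X_i = 0, transported to the dual,
    where left action is right translation of the argument.\<close>
  have E: "\<psi> (unit (eX i)) (a \<otimes>\<^bsub>R\<^esub> unit eE) = \<psi> (unit (eX i)) a" if "a \<in> carrier R" for i a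
    using fun_cong[OF mult[of "unit eE" "unit (eX i)"], of a] that by (simp add: unit_mult)
  have Y: "\<psi> (unit (eX i)) (a \<otimes>\<^bsub>R\<^esub> unit (eY j)) = \<zero>\<^bsub>K\<^esub>" if "a \<in> carrier R" for i j a
    using fun_cong[OF mult[of "unit (eY j)" "unit (eX i)"], of a] that by (simp add: unit_mult zero)
  define t where "t i = \<psi> (unit (eX i)) (unit eE)" for i
  have t [simp]: "t i \<in> carrier K" for i
    by (simp add: t_def)
  \<comment> \<open>Basis vectors of type X and F are killed by right multiplication with E, so
    \<open>E\<close> makes the functional vanish on them. For Y_j = F_jj Y_j it vanishes by
    \<open>Y\<close>.\<close>
  have eval: "\<psi> (unit (eX i)) (unit b) = (if b = eE then t i else \<zero>\<^bsub>K\<^esub>)" for i b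
    using E[of "unit b" i] Y[of "unit (eF j j)" i j for j]
    by (cases b) (auto simp: t_def unit_mult)
  have \<psi>_X: "\<psi> (unit (eX i)) = dsmult (t i) (coord eE)" for i
    by (rule dual_eq_if_basis_eq) (auto simp: eval unit_apply)
  \<comment> \<open>Two vectors on one line are dependent; this choice of coefficients cancels by
    commutativity of \<open>K\<close> without dividing by \<open>t I1\<close> or
    \<open>t I2\<close>.\<close>
  let ?z = "t I2 \<odot>\<^bsub>R\<^esub> unit (eX I1) \<oplus>\<^bsub>R\<^esub> (\<ominus>\<^bsub>K\<^esub> t I1) \<odot>\<^bsub>R\<^esub> unit (eX I2)"
  have "\<psi> ?z = \<psi> \<zero>\<^bsub>R\<^esub>"
    by (rule dual_eqI) (simp_all add: zero add smult \<psi>_X K.l_minus K.m_lcomm[of "t I2"] K.r_neg)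
  then have z: "?z = \<zero>\<^bsub>R\<^esub>"
    by (rule inj) simp_all
  \<comment> \<open>The coefficient of X_2 in the vanishing combination is the negative of
    \<open>t I1\<close>; with \<open>t I1\<close> zero, X_1 itself is mapped to zero.\<close>
  have "t I1 = \<zero>\<^bsub>K\<^esub>"
    using fun_cong[OF z, of "eX I2"] by (simp add: R9_simps unit_def)
  then have "\<psi> (unit (eX I1)) = \<psi> \<zero>\<^bsub>R\<^esub>"
    by (auto intro!: dual_eqI simp: \<psi>_X zero)
  then have "unit (eX I1) = \<zero>\<^bsub>R\<^esub>"
    by (rule inj) simp_all
  from fun_cong[OF this, of "eX I1"] show False
    by (simp add: unit_apply R9_simps)
qed

end

theorem corollary7p7:
  fixes K :: "('k, 'x) ring_scheme"
    and \<phi> :: "(((R9_basis \<Rightarrow> 'k) \<Rightarrow> 'k) \<times> ((R9_basis \<Rightarrow> 'k) \<Rightarrow> 'k) \<Rightarrow>\<^sub>0 int) set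
               \<Rightarrow> (R9_basis \<Rightarrow> 'k)"
  assumes "field K"
    and "\<phi> \<in> bimodule_isos (R9 K)
           (tensor_bimodule (R9 K) (dual_bimodule K (R9 K)) (dual_bimodule K (R9 K)))
           (regular_bimodule (R9 K))"
  shows "fd_algebra K (semitrivial_extension K (R9 K) \<phi>) \<and>
     symmetric_algebra K (semitrivial_extension K (R9 K) \<phi>) \<and>
     strongly_graded_algebra K C2 (semitrivial_extension K (R9 K) \<phi>)
       (semitrivial_grading K (R9 K)) \<and>
     fd_algebra K (trivial_component C2 (semitrivial_extension K (R9 K) \<phi>)
       (semitrivial_grading K (R9 K))) \<and>
     \<not> frobenius_algebra K (trivial_component C2 (semitrivial_extension K (R9 K) \<phi>)
       (semitrivial_grading K (R9 K)))"
proof -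
  interpret R9_algebra K
    by (rule R9_algebra.intro) fact
  interpret R9_pairing K \<phi>
    by unfold_locales fact
  show ?thesis
    using ext_fd ext_symmetric ext_strongly_graded trivial_component_fd
      frobenius_if_trivial_component_frobenius not_frobenius
    by blast
qed

end
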